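(* Let $m$ be the Bernoulli product on $[0,1)$ with parameter $0<p<1$, $p\neq 1/2$. Put $$d=-p\log_2 p-(1-p)\log_2(1-p),\qquad \sigma^2=p(1-p)\left(\log_2\frac{p}{1-p}\right)^2\quad(\sigma>0),$$ and $\Theta(t)=2^{\sqrt{2\log_2(1/t)\,\ln\ln\log_2(1/t)}}$ for $t>0$ small. Then for all $\varepsilon>0$: (1) $m\ll\mathcal H^{\Psi}$, where $\Psi(t)=t^d\,\Theta(t)^{\sigma+\varepsilon}$; (2) $m\perp\mathcal H^{\Psi}$, where $\Psi(t)=t^d\,\Theta(t)^{\sigma-\varepsilon}$. In particular, $\dim_*(m)=\dim^*(m)=d$ but $m\perp\mathcal H^d$.
   Context: Bernoulli product: the Borel probability measure $m$ on $[0,1)$ such that for all $n\ge1$ and $\varepsilon_1,\dots,\varepsilon_n\in\{0,1\}$, the dyadic interval $I_{\varepsilon_1\cdots\varepsilon_n}=\left[\sum_{i=1}^n\varepsilon_i2^{-i},\ \sum_{i=1}^n\varepsilon_i2^{-i}+2^{-n}\right)$ satisfies $m(I_{\varepsilon_1\cdots\varepsilon_n})=p^{s_n}(1-p)^{n-s_n}$ with $s_n=\varepsilon_1+\cdots+\varepsilon_n$. Generalized Hausdorff measure: for a positive function $\Psi$ defined for small $t>0$, $\mathcal H^\Psi(E)=\lim_{\eta\to0}\inf\{\sum_i\Psi(|U_i|):E\subset\bigcup_iU_i,\ 0<|U_i|\le\eta\}$ (countable covers, $|U|$ the diameter of $U$); $\mathcal H^s$ denotes $\mathcal H^\Psi$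 with $\Psi(t)=t^s$. $m\ll\mathcal H^\Psi$ means: $\mathcal H^\Psi(E)=0$ implies $m(E)=0$ for every Borel set $E$. $m\perp\mathcal H^\Psi$ means: there is a Borel set $E$ with $m(E)=1$ and $\mathcal H^\Psi(E)=0$. $\dim_*(m)=\inf\{\dim(E): m(E)>0\}$ and $\dim^*(m)=\inf\{\dim(E): m(E)=1\}$, where $E$ ranges over Borel sets and $\dim$ is Hausdorff dimension. *)

theory Defs
  imports "HOL-Probability.Probability"
begin

text \<open>
  The digits \<open>e 1, \<dots>, e n\<close> are given by a function on \<open>nat\<close> of which only the values
  on \<open>{1..n}\<close> matter.
\<close>

definition dyadic_interval :: "(nat \<Rightarrow> nat) \<Rightarrow> nat \<Rightarrow> real set" where
  "dyadic_interval e n =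
     {(\<Sum>i=1..n. real (e i) * (1/2) ^ i) ..< (\<Sum>i=1..n. real (e i) * (1/2) ^ i) + (1/2) ^ n}"

definition bernoulli_product :: "real \<Rightarrow> real measure \<Rightarrow> bool" where
  "bernoulli_product p m \<longleftrightarrow>
     prob_space m \<and> sets m = sets (restrict_space borel {0..<1}) \<and>
     (\<forall>n\<ge>1. \<forall>e. (\<forall>i\<in>{1..n}. e i \<in> {0, 1}) \<longrightarrow>
        measure m (dyadic_interval e n) = p ^ (\<Sum>i=1..n. e i) * (1 - p) ^ (n - (\<Sum>i=1..n. e i)))"

text \<open>
  Boundedness is part of \<open>0 < diameter U \<le> \<eta>\<close> mathematically, but has to be said
  explicitly because \<^const>\<open>diameter\<close> has an unspecified real value on unbounded sets.
  Families may be finite, and even empty.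
\<close>

definition fine_covers :: "real \<Rightarrow> real set \<Rightarrow> real set set set" where
  "fine_covers \<eta> E =
     {\<U>. countable \<U> \<and> E \<subseteq> \<Union>\<U> \<and> (\<forall>U\<in>\<U>. bounded U \<and> 0 < diameter U \<and> diameter U \<le> \<eta>)}"

definition hausdorff_premeasure :: "(real \<Rightarrow> real) \<Rightarrow> real \<Rightarrow> real set \<Rightarrow> ennreal" where
  "hausdorff_premeasure \<Psi> \<eta> E =
     (INF \<U>\<in>fine_covers \<eta> E. \<Sum>\<^sub>\<infinity>U\<in>\<U>. ennreal (\<Psi> (diameter U)))"

text \<open>Only the values of \<open>\<Psi>\<close> at small positive arguments are relevant.\<close>

definition hausdorff_measure :: "(real \<Rightarrow> real) \<Rightarrow> real set \<Rightarrow> ennreal" where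
  "hausdorff_measure \<Psi> E = Lim (at_right 0) (\<lambda>\<eta>. hausdorff_premeasure \<Psi> \<eta> E)"

lemma hausdorff_premeasure_antimono:
  "\<eta> \<le> \<eta>' \<Longrightarrow> hausdorff_premeasure \<Psi> \<eta>' E \<le> hausdorff_premeasure \<Psi> \<eta> E"
  unfolding hausdorff_premeasure_def
  by (rule INF_superset_mono) (auto simp: fine_covers_def intro: order_trans)

text \<open>The limit in the definition of the Hausdorff measure always exists.\<close>

lemma tendsto_hausdorff_premeasure_SUP:
  "((\<lambda>\<eta>. hausdorff_premeasure \<Psi> \<eta> E) \<longlongrightarrow> (SUP \<eta>\<in>{0<..}. hausdorff_premeasure \<Psi> \<eta> E)) (at_right 0)"
proof (rule order_tendstoI)
  fix a assume "a < (SUP \<eta>\<in>{0<..}. hausdorff_premeasure \<Psi> \<eta> E)"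
  then obtain \<delta> where \<delta>: "\<delta> > 0" "a < hausdorff_premeasure \<Psi> \<delta> E"
    by (auto simp: less_SUP_iff)
  show "eventually (\<lambda>\<eta>. a < hausdorff_premeasure \<Psi> \<eta> E) (at_right 0)"
    using eventually_at_right_real[OF \<delta>(1)]
  proof eventually_elim
    case (elim \<eta>)
    then have "\<eta> \<le> \<delta>" by simp
    from less_le_trans[OF \<delta>(2) hausdorff_premeasure_antimono[OF this]] show ?case .
  qed
next
  fix a assume a: "(SUP \<eta>\<in>{0<..}. hausdorff_premeasure \<Psi> \<eta> E) < a"
  show "eventually (\<lambda>\<eta>. hausdorff_premeasure \<Psi> \<eta> E < a) (at_right 0)"
    using eventually_at_right_less[of "0::real"]
  proof eventually_elim
    case (elim \<eta>)
    then have "\<eta> \<in> {0<..}" by simp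
    from le_less_trans[OF SUP_upper[OF this] a] show ?case .
  qed
qed

lemma hausdorff_measure_eq_SUP:
  "hausdorff_measure \<Psi> E = (SUP \<eta>\<in>{0<..}. hausdorff_premeasure \<Psi> \<eta> E)"
  unfolding hausdorff_measure_def
  by (rule tendsto_Lim) (simp_all add: tendsto_hausdorff_premeasure_SUP)

lemma tendsto_hausdorff_measure:
  "((\<lambda>\<eta>. hausdorff_premeasure \<Psi> \<eta> E) \<longlongrightarrow> hausdorff_measure \<Psi> E) (at_right 0)"
  using tendsto_hausdorff_premeasure_SUP by (simp add: hausdorff_measure_eq_SUP)

definition hausdorff_dim :: "real set \<Rightarrow> ereal" where
  "hausdorff_dim E = (INF s\<in>{s. 0 \<le> s \<and> hausdorff_measure (\<lambda>t. t powr s) E = 0}. ereal s)"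

definition abs_cont_hausdorff :: "real measure \<Rightarrow> (real \<Rightarrow> real) \<Rightarrow> bool" where
  "abs_cont_hausdorff m \<Psi> \<longleftrightarrow> (\<forall>E\<in>sets m. hausdorff_measure \<Psi> E = 0 \<longrightarrow> emeasure m E = 0)"

definition singular_hausdorff :: "real measure \<Rightarrow> (real \<Rightarrow> real) \<Rightarrow> bool" where
  "singular_hausdorff m \<Psi> \<longleftrightarrow> (\<exists>E\<in>sets m. emeasure m E = 1 \<and> hausdorff_measure \<Psi> E = 0)"

definition lower_dim :: "real measure \<Rightarrow> ereal" where
  "lower_dim m = (INF E\<in>{E\<in>sets m. emeasure m E > 0}. hausdorff_dim E)"

definition upper_dim :: "real measure \<Rightarrow> ereal" where
  "upper_dim m = (INF E\<in>{E\<in>sets m. emeasure m E = 1}. hausdorff_dim E)"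

text \<open>
  The formula is meaningful for \<open>0 < t \<le> 2 powr (- exp 1)\<close>, where the radicand is
  nonnegative.
\<close>

definition Theta :: "real \<Rightarrow> real" where
  "Theta t = 2 powr sqrt (2 * log 2 (1 / t) * ln (ln (log 2 (1 / t))))"

end

theory Submission
  imports Defs "HOL-Real_Asymp.Real_Asymp"
begin

text \<open>
  The binary digits of a point chosen by a Bernoulli product \<open>m\<close> are independent coin tosses,
  and the measure of the dyadic interval \<open>I\<^sub>n(x)\<close> of generation \<open>n\<close> around \<open>x\<close> depends only on
  the number of ones among the first \<open>n\<close> digits of \<open>x\<close>:
  \<open>m(I\<^sub>n(x)) = 2 powr (- d n + T\<^sub>n(x))\<close>, where \<open>T\<^sub>n\<close> is \<open>log 2 (p / (1 - p))\<close> times the centred number of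
  ones.  So \<open>T\<^sub>n\<close> is a sum of \<open>n\<close> independent centred variables of variance \<open>\<sigma>\<^sup>2\<close>, and since
  \<open>Theta (2 powr - n) = 2 powr sqrt (2 n ln (ln n))\<close>, the law of the iterated logarithm
  \<open>limsup T\<^sub>n / sqrt (2 n ln (ln n)) = \<sigma>\<close> says that \<open>Theta\<close> to the power \<open>\<sigma>\<close> is the exact order by which
  \<open>m(I\<^sub>n(x))\<close> almost surely exceeds \<open>2 powr (- d n)\<close> infinitely often.  Both claims are then covering arguments.

  Write \<open>\<Psi>(t) = t powr d * Theta t powr s\<close>.  For \<open>s > \<sigma>\<close>, almost every point satisfies \<open>m(I\<^sub>n(x)) \<le> \<Psi>(2 powr - n)\<close> from some generation on.
  A set meets at most two dyadic intervals of any generation whose length is at least its diameter, so on the points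
  where the bound holds from a fixed generation on, \<open>m\<close> is at most a constant times \<open>\<H>\<^sup>\<Psi>\<close>; this is the mass
  distribution principle (\<open>emeasure_light_eq_0\<close>, \<open>abs_cont_above\<close>).

  For \<open>s < \<sigma>\<close>, almost every point lies in arbitrarily short dyadic intervals whose measure exceeds
  \<open>\<Psi>(2 powr - n)\<close> by a factor that tends to infinity.  Taking around each point the longest such
  interval below a given length gives a disjoint cover, for which the sum of the \<open>\<Psi>(2 powr - n)\<close> is at most
  the total mass divided by that factor (\<open>singular_below\<close>).

  The dimensions follow because every positive power of \<open>Theta t\<close> grows more slowly than any negative
  power of \<open>t\<close>, and the singularity with respect to \<open>t powr d\<close> is the case \<open>s = 0\<close>.

  The two halves of the law of the iterated logarithm rest on Gaussian tail estimates with the sharp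
  constant in the exponent (\<open>coins_upper_tail\<close>, \<open>coins_lower_tail\<close>), both obtained by comparing the tosses of
  a \<open>p\<close>-coin with a tilted law: an exponential supermartingale and its maximal inequality bound the
  probability of large sums from above, while tossing a \<open>q\<close>-coin that makes the large sum typical bounds it
  from below, at a cost measured by the relative entropy of \<open>q\<close> with respect to \<open>p\<close>.  The Borel-Cantelli lemmas
  along geometric sequences of times finish the argument (\<open>lil_upper\<close>, \<open>lil_lower\<close>).
\<close>

section \<open>Words of independent coin tosses\<close>

abbreviation coins :: "real \<Rightarrow> nat \<Rightarrow> bool list pmf" where
  "coins p n \<equiv> replicate_pmf n (bernoulli_pmf p)"

definition excess :: "real \<Rightarrow> bool list \<Rightarrow> real" where
  "excess p w = (\<Sum>b\<leftarrow>w. of_bool b - p)"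

lemma excess_Nil [simp]: "excess p [] = 0"
  and excess_Cons [simp]: "excess p (b # w) = of_bool b - p + excess p w"
  and excess_append: "excess p (u @ w) = excess p u + excess p w"
  by (simp_all add: excess_def)

lemma length_coins: "w \<in> set_pmf (coins p n) \<Longrightarrow> length w = n"
  by (auto simp: set_replicate_pmf)

lemma finite_set_coins [simp]: "finite (set_pmf (coins p n))"
proof (rule finite_subset)
  show "set_pmf (coins p n) \<subseteq> {w. set w \<subseteq> UNIV \<and> length w = n}"
    by (auto simp: set_replicate_pmf)
qed (rule finite_lists_length_eq, simp)

lemma expectation_coins_Suc:
  assumes "0 \<le> p" "p \<le> 1"
  shows "measure_pmf.expectation (coins p (Suc n)) f =
           p * measure_pmf.expectation (coins p n) (\<lambda>w. f (True # w)) +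
           (1 - p) * measure_pmf.expectation (coins p n) (\<lambda>w. f (False # w :: bool list) :: real)"
proof -
  have *: "measure_pmf.expectation (coins p n \<bind> (\<lambda>xs. return_pmf (b # xs))) f
        = measure_pmf.expectation (coins p n) (\<lambda>w. f (b # w))" for b
    by (simp add: map_pmf_def[symmetric])
  show ?thesis
    unfolding replicate_pmf.simps
    by (subst pmf_expectation_bind[where A = UNIV])
       (use assms in \<open>auto simp: * UNIV_bool simp del: bind_return_pmf\<close>)
qed

lemma prob_eq_expectation: "measure_pmf.prob M A = measure_pmf.expectation M (\<lambda>x. indicator A x)"
  by simp

lemma prob_coins_Suc:
  assumes "0 \<le> p" "p \<le> 1"
  shows "measure_pmf.prob (coins p (Suc n)) A =
           p * measure_pmf.prob (coins p n) {w. True # w \<in> A} +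
           (1 - p) * measure_pmf.prob (coins p n) {w. False # w \<in> A}"
proof -
  have "indicator A (b # w) = (indicator {w. b # w \<in> A} w :: real)" for b w
    by (auto simp: indicator_def)
  then show ?thesis
    unfolding prob_eq_expectation expectation_coins_Suc[OF assms] by simp
qed

text \<open>
  A long word is the concatenation of two independent shorter ones.
\<close>

lemma prob_coins_append:
  "measure_pmf.prob (coins p (m + n)) {w. take m w \<in> A \<and> drop m w \<in> B} =
     measure_pmf.prob (coins p m) A * measure_pmf.prob (coins p n) B"
proof -
  have "coins p (m + n) = map_pmf (\<lambda>(u, v). u @ v) (pair_pmf (coins p m) (coins p n))"
    by (simp add: replicate_pmf_distrib pair_pmf_def map_bind_pmf bind_assoc_pmf bind_return_pmf)
  then have "measure_pmf.prob (coins p (m + n)) {w. take m w \<in> A \<and> drop m w \<in> B} =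
      measure_pmf.prob (pair_pmf (coins p m) (coins p n))
        {(u, v). take m (u @ v) \<in> A \<and> drop m (u @ v) \<in> B}"
    by (simp add: case_prod_beta' vimage_def)
  also have "\<dots> = measure_pmf.prob (pair_pmf (coins p m) (coins p n)) (A \<times> B)"
    by (intro measure_prob_cong_0) (auto simp: pmf_eq_0_set_pmf dest!: length_coins)
  also have "\<dots> = measure_pmf.prob (coins p m) A * measure_pmf.prob (coins p n) B"
    by (rule measure_pmf_prob_product) (auto simp: countableI_type)
  finally show ?thesis .
qed

lemma expectation_excess:
  assumes "0 \<le> q" "q \<le> 1"
  shows "measure_pmf.expectation (coins q n) (excess q) = 0"
proof (induction n)
  case (Suc n)
  have *: "measure_pmf.expectation (coins q n) (\<lambda>w. a + excess q w) = a" for a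
    using Suc by (simp add: integrable_measure_pmf_finite)
  then show ?case
    unfolding expectation_coins_Suc[OF assms] excess_Cons by (simp only: *) (simp add: algebra_simps)
qed simp

lemma expectation_excess_square:
  assumes "0 \<le> q" "q \<le> 1"
  shows "measure_pmf.expectation (coins q n) (\<lambda>w. (excess q w)\<^sup>2) = n * (q * (1 - q))"
proof (induction n)
  case (Suc n)
  have *: "measure_pmf.expectation (coins q n) (\<lambda>w. (a + excess q w)\<^sup>2) = a\<^sup>2 + n * (q * (1 - q))" for a
    using Suc expectation_excess[OF assms]
    by (simp add: power2_sum integrable_measure_pmf_finite mult.assoc)
  then show ?case
    unfolding expectation_coins_Suc[OF assms] excess_Cons
    by (simp only: *) (simp add: algebra_simps power2_eq_square)
qed simp

text \<open>
  This is Ville's inequality for the supermartingale formed by the partial products of the \<open>l b\<close>.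
  Splitting off the first toss \<open>b\<close> turns the event with threshold \<open>a\<close> into the same event with
  threshold \<open>a / l b\<close> for the remaining tosses, and averaging the two bounds \<open>l b / a\<close> over \<open>b\<close> gives at
  most \<open>1 / a\<close>; the product of no factors matters only for \<open>a \<le> 1\<close>, where the bound is trivial.
\<close>

theorem maximal_inequality_coins:
  fixes l :: "bool \<Rightarrow> real"
  assumes p: "0 \<le> p" "p \<le> 1" and l: "\<And>b. l b > 0" "p * l True + (1 - p) * l False \<le> 1"
  shows "a > 0 \<Longrightarrow>
    measure_pmf.prob (coins p n) {w. \<exists>k\<le>n. prod_list (map l (take k w)) \<ge> a} \<le> 1 / a"
proof (induction n arbitrary: a)
  case 0
  have "measure_pmf.prob (coins p 0) {w. \<exists>k\<le>0. prod_list (map l (take k w)) \<ge> a} \<le> 1 / a" if "a \<le> 1"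
    by (rule order_trans[OF measure_pmf.prob_le_1]) (use that 0 in auto)
  then show ?case using 0 by (cases "a \<le> 1") auto
next
  case (Suc n)
  show ?case
  proof (cases "a \<le> 1")
    case True
    show ?thesis by (rule order_trans[OF measure_pmf.prob_le_1]) (use True Suc in auto)
  next
    case False
    have "{w. b # w \<in> {w. \<exists>k\<le>Suc n. prod_list (map l (take k w)) \<ge> a}}
        = {w. \<exists>k\<le>n. prod_list (map l (take k w)) \<ge> a / l b}" for b
    proof -
      have "(\<exists>k\<le>Suc n. prod_list (map l (take k (b # w))) \<ge> a) \<longleftrightarrow>
            (\<exists>k\<le>n. prod_list (map l (take k w)) \<ge> a / l b)" for w
      proof -
        have "(\<exists>k\<le>Suc n. Q k) \<longleftrightarrow> (\<exists>k\<le>n. Q (Suc k))" if "\<not> Q 0" for Q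
          using that by (metis Suc_le_mono not0_implies_Suc)
        from this[of "\<lambda>k. prod_list (map l (take k (b # w))) \<ge> a"]
        have "(\<exists>k\<le>Suc n. prod_list (map l (take k (b # w))) \<ge> a) \<longleftrightarrow>
            (\<exists>k\<le>n. prod_list (map l (take (Suc k) (b # w))) \<ge> a)"
          using False by simp
        then show ?thesis using l(1)[of b] by (simp add: field_simps)
      qed
      then show ?thesis by simp
    qed
    then have "measure_pmf.prob (coins p (Suc n)) {w. \<exists>k\<le>Suc n. prod_list (map l (take k w)) \<ge> a}
       = p * measure_pmf.prob (coins p n) {w. \<exists>k\<le>n. prod_list (map l (take k w)) \<ge> a / l True}
       + (1 - p) * measure_pmf.prob (coins p n) {w. \<exists>k\<le>n. prod_list (map l (take k w)) \<ge> a / l False}"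
      by (simp only: prob_coins_Suc[OF p])
    also have "\<dots> \<le> p * (1 / (a / l True)) + (1 - p) * (1 / (a / l False))"
      using p l(1) Suc.prems by (intro add_mono mult_left_mono Suc.IH) auto
    also have "\<dots> = (p * l True + (1 - p) * l False) / a"
      by (simp add: add_divide_distrib)
    also have "\<dots> \<le> 1 / a"
      using l(2) Suc.prems by (intro divide_right_mono) auto
    finally show ?thesis .
  qed
qed

definition word_weight :: "real \<Rightarrow> bool list \<Rightarrow> real" where
  "word_weight p w = (\<Prod>b\<leftarrow>w. if b then p else 1 - p)"

lemma pmf_coins:
  assumes "0 \<le> p" "p \<le> 1"
  shows "pmf (coins p n) w = (if length w = n then word_weight p w else 0)"
proof (induction n arbitrary: w)
  case 0
  then show ?case by (auto simp: word_weight_def)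
next
  case (Suc n)
  have eq: "pmf (coins p (Suc n)) w = p * measure_pmf.prob (coins p n) {w'. True # w' \<in> {w}} +
           (1 - p) * measure_pmf.prob (coins p n) {w'. False # w' \<in> {w}}"
    using prob_coins_Suc[OF assms, of n "{w}"] by (simp add: measure_pmf_single)
  then show ?case
  proof (cases w)
    case (Cons b v)
    have "{w'. b' # w' \<in> {w}} = (if b' = b then {v} else {})" for b'
      using Cons by auto
    then show ?thesis
      using eq Suc[of v] Cons by (auto simp: measure_pmf_single word_weight_def simp del: replicate_pmf.simps)
  qed (simp add: eq)
qed

definition kl_divergence :: "real \<Rightarrow> real \<Rightarrow> real" where
  "kl_divergence q p = q * ln (q / p) + (1 - q) * ln ((1 - q) / (1 - p))"

definition log_odds_ratio :: "real \<Rightarrow> real \<Rightarrow> real" where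
  "log_odds_ratio q p = ln (q / p) - ln ((1 - q) / (1 - p))"

text \<open>
  The likelihood ratio of the two coins on a word is governed by its deterministic part, the relative
  entropy times the length, and by a fluctuation proportional to the excess over \<open>q\<close>.
\<close>

lemma word_weight_change:
  assumes "0 < p" "p < 1" "0 < q" "q < 1"
  shows "word_weight p w =
    word_weight q w * exp (- (length w * kl_divergence q p + excess q w * log_odds_ratio q p))"
proof (induction w)
  case (Cons b w)
  let ?K = "kl_divergence q p" and ?R = "log_odds_ratio q p"
  have "(if b then p else 1 - p) = (if b then q else 1 - q) * exp (- (?K + (of_bool b - q) * ?R))"
  proof (cases b)
    case True
    have "?K + (1 - q) * ?R = ln (q / p)"
      by (simp add: kl_divergence_def log_odds_ratio_def algebra_simps)
    then show ?thesis using True assms by (simp add: exp_minus)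
  next
    case False
    have "?K + (0 - q) * ?R = ln ((1 - q) / (1 - p))"
      by (simp add: kl_divergence_def log_odds_ratio_def algebra_simps)
    then show ?thesis using False assms by (simp add: exp_minus)
  qed
  then have "word_weight p (b # w) = (if b then q else 1 - q) * word_weight q w *
      (exp (- (?K + (of_bool b - q) * ?R)) * exp (- (length w * ?K + excess q w * ?R)))"
    using Cons by (simp add: word_weight_def)
  also have "\<dots> = word_weight q (b # w) * exp (- (length (b # w) * ?K + excess q (b # w) * ?R))"
    by (simp add: word_weight_def flip: exp_add) (simp add: algebra_simps)
  finally show ?case .
qed (simp add: word_weight_def)

text \<open>
  An event that forces the fluctuation of the likelihood ratio to be at most \<open>y\<close> costs at
  most a fixed factor when the \<open>q\<close>-coin is replaced by the \<open>p\<close>-coin.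
\<close>

lemma prob_coins_ge_tilted:
  assumes p: "0 < p" "p < 1" and q: "0 < q" "q < 1"
    and A: "\<And>w. w \<in> A \<Longrightarrow> length w = n \<Longrightarrow> \<bar>excess q w\<bar> \<le> y"
  shows "exp (- (n * kl_divergence q p + y * \<bar>log_odds_ratio q p\<bar>)) * measure_pmf.prob (coins q n) A
      \<le> measure_pmf.prob (coins p n) A"
proof -
  let ?F = "{w \<in> A. length w = n}"
  have fin: "finite ?F"
    by (rule finite_subset[OF _ finite_lists_length_eq[of UNIV n]]) auto
  have eq: "measure_pmf.prob (coins r n) A = (\<Sum>w\<in>?F. word_weight r w)" if "0 < r" "r < 1" for r
  proof -
    have "measure_pmf.prob (coins r n) A = measure_pmf.prob (coins r n) ?F"
      by (intro measure_prob_cong_0) (auto simp: pmf_eq_0_set_pmf dest!: length_coins)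
    also have "\<dots> = (\<Sum>w\<in>?F. pmf (coins r n) w)"
      by (rule measure_measure_pmf_finite[OF fin])
    also have "\<dots> = (\<Sum>w\<in>?F. word_weight r w)"
      by (rule sum.cong) (use that in \<open>auto simp: pmf_coins\<close>)
    finally show ?thesis .
  qed
  have "exp (- (n * kl_divergence q p + y * \<bar>log_odds_ratio q p\<bar>)) * word_weight q w \<le> word_weight p w"
    if "w \<in> ?F" for w
  proof -
    have "excess q w * log_odds_ratio q p \<le> \<bar>excess q w\<bar> * \<bar>log_odds_ratio q p\<bar>"
      by (simp add: abs_mult[symmetric])
    also have "\<dots> \<le> y * \<bar>log_odds_ratio q p\<bar>"
      using A that by (intro mult_right_mono) auto
    finally have "exp (- (n * kl_divergence q p + y * \<bar>log_odds_ratio q p\<bar>)) \<le> 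
      exp (- (length w * kl_divergence q p + excess q w * log_odds_ratio q p))"
      using that by simp
    moreover have "word_weight q w \<ge> 0"
      unfolding word_weight_def by (rule prod_list_nonneg) (use q in auto)
    ultimately show ?thesis
      by (subst word_weight_change[OF p q]) (simp add: mult.commute mult_left_mono)
  qed
  then show ?thesis
    unfolding eq[OF p] eq[OF q] sum_distrib_left by (intro sum_mono) auto
qed

section \<open>Moderate deviations\<close>

text \<open>
  Second-order expansions at \<open>0\<close> of the exponential, and of the relative entropy of the coin \<open>p + u\<close>.
  They produce the variance \<open>p (1 - p)\<close> in both tail estimates, with constants that agree up to an
  arbitrarily small relative error.
\<close>

lemma exp_asymptotics: "((\<lambda>z::real. (exp z - 1 - z) / z\<^sup>2) \<longlongrightarrow> 1 / 2) (at 0)"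
  by real_asymp

lemma kl_divergence_asymptotics:
  assumes "0 < p" "p < 1"
  shows "((\<lambda>u. kl_divergence (p + u) p / u\<^sup>2) \<longlongrightarrow> 1 / (2 * p * (1 - p))) (at 0)"
proof -
  have "1 / (2 * p * (1 - p)) = inverse p * p * inverse p -
      p * (inverse p * p * inverse p * (inverse p * p * inverse p)) / 2 +
      (inverse (1 - p) * (1 - p) * inverse (1 - p) -
       (1 - p) * (inverse (1 - p) * (1 - p) * inverse (1 - p) *
         (inverse (1 - p) * (1 - p) * inverse (1 - p))) / 2)"
  proof -
    have *: "inverse r * r * inverse r = 1 / r" "r * (1 / r * (1 / r)) = 1 / r" if "r > 0" for r :: real
      using that by (auto simp: field_simps)
    have "1 / (2 * p * (1 - p)) = 1 / p - 1 / p / 2 + (1 / (1 - p) - 1 / (1 - p) / 2)"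
      using assms by (simp add: divide_simps)
    then show ?thesis
      using assms by (simp only: * diff_gt_0_iff_gt)
  qed
  then show ?thesis
    unfolding kl_divergence_def using assms by real_asymp
qed

lemma log_odds_ratio_asymptotics:
  assumes "0 < p" "p < 1"
  shows "((\<lambda>u. log_odds_ratio (p + u) p / u) \<longlongrightarrow> 1 / (p * (1 - p))) (at 0)"
proof -
  have "1 / (p * (1 - p)) = inverse p * p * inverse p + inverse (1 - p) * (1 - p) * inverse (1 - p)"
    using assms by (simp add: field_simps)
  then show ?thesis
    unfolding log_odds_ratio_def using assms by real_asymp
qed

lemma centered_mgf_le:
  fixes p \<delta> :: real
  assumes p: "0 < p" "p < 1" and "\<delta> > 0"
  obtains r where "r > 0" "\<And>z. \<bar>z\<bar> \<le> r \<Longrightarrow>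
    p * exp (z * (1 - p)) + (1 - p) * exp (- z * p) \<le> exp ((1 + \<delta>) * (p * (1 - p)) * z\<^sup>2 / 2)"
proof -
  have "1 / 2 < (1 + \<delta>) / 2"
    using assms by simp
  from order_tendstoD(2)[OF exp_asymptotics this]
  obtain r where r: "r > 0" and
    *: "\<And>z. z \<noteq> 0 \<Longrightarrow> \<bar>z\<bar> < r \<Longrightarrow> (exp z - 1 - z) / z\<^sup>2 < (1 + \<delta>) / 2"
    by (auto simp: eventually_at dist_real_def)
  have quad: "exp z \<le> 1 + z + (1 + \<delta>) / 2 * z\<^sup>2" if "\<bar>z\<bar> < r" for z
    using *[of z] that by (cases "z = 0") (simp_all add: pos_divide_less_eq)
  have "p * exp (z * (1 - p)) + (1 - p) * exp (- z * p) \<le> exp ((1 + \<delta>) * (p * (1 - p)) * z\<^sup>2 / 2)"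
    if z: "\<bar>z\<bar> \<le> r / 2" for z
  proof -
    have "\<bar>z * s\<bar> < r" if "\<bar>s\<bar> \<le> 1" for s
      using mult_mono[OF z that] r by (simp add: abs_mult)
    then have "p * exp (z * (1 - p)) + (1 - p) * exp (- z * p)
        \<le> p * (1 + z * (1 - p) + (1 + \<delta>) / 2 * (z * (1 - p))\<^sup>2)
          + (1 - p) * (1 + - z * p + (1 + \<delta>) / 2 * (- z * p)\<^sup>2)"
      using p by (intro add_mono mult_left_mono quad) auto
    also have "\<dots> = 1 + (1 + \<delta>) * (p * (1 - p)) * z\<^sup>2 / 2"
      by (simp add: field_simps) (simp add: power2_eq_square algebra_simps)
    also have "\<dots> \<le> exp ((1 + \<delta>) * (p * (1 - p)) * z\<^sup>2 / 2)"
      by (rule exp_ge_add_one_self)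
    finally show ?thesis .
  qed
  with r show thesis using that[of "r / 2"] by simp
qed

lemma kl_divergence_le:
  assumes p: "0 < p" "p < 1" and "\<delta> > 0"
  obtains r where "r > 0"
    "\<And>u. \<bar>u\<bar> \<le> r \<Longrightarrow> kl_divergence (p + u) p \<le> (1 + \<delta>) * u\<^sup>2 / (2 * (p * (1 - p)))"
    "\<And>u. \<bar>u\<bar> \<le> r \<Longrightarrow> \<bar>log_odds_ratio (p + u) p\<bar> \<le> (1 + \<delta>) * \<bar>u\<bar> / (p * (1 - p))"
proof -
  have pos: "p * (1 - p) > 0" using p by simp
  have "1 / (2 * p * (1 - p)) < (1 + \<delta>) / (2 * (p * (1 - p)))"
    using assms by (simp add: divide_simps)
  from order_tendstoD(2)[OF kl_divergence_asymptotics[OF p] this]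
  obtain r1 where r1: "r1 > 0" and
    1: "\<And>u. u \<noteq> 0 \<Longrightarrow> \<bar>u\<bar> < r1 \<Longrightarrow> kl_divergence (p + u) p / u\<^sup>2 < (1 + \<delta>) / (2 * (p * (1 - p)))"
    by (auto simp: eventually_at dist_real_def)
  have "1 / (p * (1 - p)) < (1 + \<delta>) / (p * (1 - p))"
    using assms by (simp add: divide_simps)
  moreover have "((\<lambda>u. \<bar>log_odds_ratio (p + u) p / u\<bar>) \<longlongrightarrow> 1 / (p * (1 - p))) (at 0)"
    using tendsto_rabs[OF log_odds_ratio_asymptotics[OF p]] p by simp
  ultimately have "\<forall>\<^sub>F u in at 0. \<bar>log_odds_ratio (p + u) p / u\<bar> < (1 + \<delta>) / (p * (1 - p))"
    using order_tendstoD(2) by blast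
  then obtain r2 where r2: "r2 > 0" and
    2: "\<And>u. u \<noteq> 0 \<Longrightarrow> \<bar>u\<bar> < r2 \<Longrightarrow> \<bar>log_odds_ratio (p + u) p / u\<bar> < (1 + \<delta>) / (p * (1 - p))"
    by (auto simp: eventually_at dist_real_def)
  show thesis
  proof (rule that[of "min r1 r2 / 2"])
    show "min r1 r2 / 2 > 0" using r1 r2 by simp
    fix u assume u: "\<bar>u\<bar> \<le> min r1 r2 / 2"
    show "kl_divergence (p + u) p \<le> (1 + \<delta>) * u\<^sup>2 / (2 * (p * (1 - p)))"
    proof (cases "u = 0")
      case False
      then have "kl_divergence (p + u) p / u\<^sup>2 < (1 + \<delta>) / (2 * (p * (1 - p)))"
        using u r1 r2 by (intro 1) auto
      then have "kl_divergence (p + u) p < (1 + \<delta>) / (2 * (p * (1 - p))) * u\<^sup>2"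
        using False by (simp add: pos_divide_less_eq)
      then show ?thesis by simp
    qed (simp add: kl_divergence_def)
    show "\<bar>log_odds_ratio (p + u) p\<bar> \<le> (1 + \<delta>) * \<bar>u\<bar> / (p * (1 - p))"
    proof (cases "u = 0")
      case False
      then have "\<bar>log_odds_ratio (p + u) p\<bar> / \<bar>u\<bar> < (1 + \<delta>) / (p * (1 - p))"
        using 2[of u] u r1 r2 by (simp add: abs_divide)
      then have "\<bar>log_odds_ratio (p + u) p\<bar> < (1 + \<delta>) / (p * (1 - p)) * \<bar>u\<bar>"
        using False by (simp add: pos_divide_less_eq)
      then show ?thesis by simp
    qed (simp add: log_odds_ratio_def)
  qed
qed

text \<open>
  Chernoff's method, applied to the running maximum.  The weights \<open>exp (t c (b - p) - v t\<^sup>2 / 2)\<close> have mean at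
  most \<open>1\<close> as soon as \<open>v\<close> exceeds the variance and \<open>t\<close> is small enough; the restriction
  \<open>x \<le> \<kappa> n\<close> is what keeps the optimal \<open>t = x / (n v)\<close> small.
\<close>

proposition coins_upper_tail:
  assumes p: "0 < p" "p < 1" and "c \<noteq> 0" and "\<delta> > 0"
  obtains \<kappa> where "\<kappa> > 0"
    "\<And>n x. 0 \<le> x \<Longrightarrow> x \<le> \<kappa> * real n \<Longrightarrow>
       measure_pmf.prob (coins p n) {w. \<exists>k\<le>n. x \<le> c * excess p (take k w)}
       \<le> exp (- x\<^sup>2 / (2 * n * ((1 + \<delta>) * (p * (1 - p) * c\<^sup>2))))"
proof -
  obtain r where r: "r > 0" and
    mgf: "\<And>z. \<bar>z\<bar> \<le> r \<Longrightarrow>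
      p * exp (z * (1 - p)) + (1 - p) * exp (- z * p) \<le> exp ((1 + \<delta>) * (p * (1 - p)) * z\<^sup>2 / 2)"
    using centered_mgf_le[OF p \<open>\<delta> > 0\<close>] by blast
  define v where "v = (1 + \<delta>) * (p * (1 - p) * c\<^sup>2)"
  have v: "v > 0" using assms by (simp add: v_def)
  show thesis
  proof (rule that[of "r * v / \<bar>c\<bar>"], goal_cases)
    case 1
    show ?case using r v \<open>c \<noteq> 0\<close> by simp
  next
    case (2 n x)
    show ?case
    proof (cases "n = 0")
      case True
      then show ?thesis by simp
    next
      case False
      \<comment> \<open>This t minimises - t x + n v t^2 / 2.\<close>
      define t where "t = x / (n * v)"
      define l where "l b = exp (t * (c * (of_bool b - p)) - v * t\<^sup>2 / 2)" for b
      have t: "t \<ge> 0" using 2 v by (simp add: t_def)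
      have "\<bar>t * c\<bar> \<le> r"
        using 2(2) False v t \<open>c \<noteq> 0\<close> by (simp add: t_def abs_mult field_simps)
      from mgf[OF this] have "p * exp (t * c * (1 - p)) + (1 - p) * exp (- (t * c) * p) \<le> exp (v * t\<^sup>2 / 2)"
        by (simp add: v_def power_mult_distrib mult_ac)
      moreover have "p * l True + (1 - p) * l False =
          (p * exp (t * c * (1 - p)) + (1 - p) * exp (- (t * c) * p)) / exp (v * t\<^sup>2 / 2)"
        by (simp add: l_def exp_diff add_divide_distrib mult.assoc)
      ultimately have l: "p * l True + (1 - p) * l False \<le> 1"
        by simp
      have prod: "prod_list (map l w) = exp (t * (c * excess p w) - length w * (v * t\<^sup>2 / 2))" for w
      proof (induction w)
        case (Cons b w)
        have "prod_list (map l (b # w)) = exp ((t * (c * (of_bool b - p)) - v * t\<^sup>2 / 2) +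
            (t * (c * excess p w) - length w * (v * t\<^sup>2 / 2)))"
          by (simp only: exp_add list.map prod_list.Cons Cons.IH l_def[of b])
        also have "(t * (c * (of_bool b - p)) - v * t\<^sup>2 / 2) + (t * (c * excess p w) - length w * (v * t\<^sup>2 / 2))
            = t * (c * excess p (b # w)) - length (b # w) * (v * t\<^sup>2 / 2)"
          by (simp add: algebra_simps)
        finally show ?case .
      qed simp
      \<comment> \<open>The drift term up to a time k \<le> n is at most the one up to time n.\<close>
      have "{w. \<exists>k\<le>n. x \<le> c * excess p (take k w)}
          \<subseteq> {w. \<exists>k\<le>n. exp (t * x - n * (v * t\<^sup>2 / 2)) \<le> prod_list (map l (take k w))}"
      proof clarify
        fix w k assume k: "k \<le> n" "x \<le> c * excess p (take k w)"
        have "real (length (take k w)) * (v * t\<^sup>2 / 2) \<le> n * (v * t\<^sup>2 / 2)"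
          using k(1) v by (intro mult_right_mono) auto
        moreover have "t * x \<le> t * (c * excess p (take k w))"
          using k(2) t by (rule mult_left_mono)
        ultimately show "\<exists>k\<le>n. exp (t * x - n * (v * t\<^sup>2 / 2)) \<le> prod_list (map l (take k w))"
          using k(1) unfolding prod by (intro exI[of _ k]) auto
      qed
      then have "measure_pmf.prob (coins p n) {w. \<exists>k\<le>n. x \<le> c * excess p (take k w)}
          \<le> measure_pmf.prob (coins p n) {w. \<exists>k\<le>n. exp (t * x - n * (v * t\<^sup>2 / 2)) \<le> prod_list (map l (take k w))}"
        by (intro measure_pmf.finite_measure_mono) auto
      also have "\<dots> \<le> 1 / exp (t * x - n * (v * t\<^sup>2 / 2))"
        by (rule maximal_inequality_coins) (use p l in \<open>auto simp: l_def\<close>)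
      also have "\<dots> = exp (- (t * x - n * (v * t\<^sup>2 / 2)))"
        by (simp add: exp_minus field_simps)
      also have "t * x - n * (v * t\<^sup>2 / 2) = x\<^sup>2 / (2 * n * v)"
      proof -
        have "n * (v * t\<^sup>2 / 2) = t * x / 2" using False v by (simp add: t_def power2_eq_square)
        then show ?thesis using False v by (simp add: t_def power2_eq_square)
      qed
      finally show ?thesis by (simp add: v_def)
    qed
  qed
qed

lemma excess_change: "excess p w = excess q w + real (length w) * (q - p)"
  by (induction w) (simp_all add: algebra_simps)

text \<open>
  A standard deviation is at most \<open>sqrt n / 2\<close> for every coin, so \<open>2 y\<^sup>2 \<ge> n\<close> makes \<open>y\<close> at least
  \<open>sqrt 2\<close> standard deviations.
\<close>

lemma chebyshev_coins:
  assumes "0 \<le> q" "q \<le> 1" "y > 0" "real n \<le> 2 * y\<^sup>2"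
  shows "1 / 2 \<le> measure_pmf.prob (coins q n) {w. length w = n \<and> \<bar>excess q w\<bar> \<le> y}"
proof -
  let ?P = "measure_pmf.prob (coins q n)"
  have "?P {w. y \<le> \<bar>excess q w\<bar>} \<le> n * (q * (1 - q)) / y\<^sup>2"
    using measure_pmf.Chebyshev_inequality[of "excess q" "coins q n" y] assms
    by (simp add: expectation_excess expectation_excess_square integrable_measure_pmf_finite)
  also have "\<dots> \<le> n * (1 / 4) / y\<^sup>2"
  proof -
    have "q * (1 - q) \<le> 1 / 4"
      using zero_le_power2[of "q - 1 / 2"] by (simp add: power2_eq_square algebra_simps)
    then show ?thesis by (intro divide_right_mono mult_left_mono) auto
  qed
  also have "\<dots> \<le> 1 / 2"
    using assms by (simp add: field_simps)
  finally have "?P {w. y \<le> \<bar>excess q w\<bar>} \<le> 1 / 2" .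
  moreover have "?P (UNIV - {w. y \<le> \<bar>excess q w\<bar>}) = 1 - ?P {w. y \<le> \<bar>excess q w\<bar>}"
    using measure_pmf.prob_compl[of "{w. y \<le> \<bar>excess q w\<bar>}" "coins q n"] by simp
  moreover have "?P (UNIV - {w. y \<le> \<bar>excess q w\<bar>})
      \<le> ?P {w. length w = n \<and> \<bar>excess q w\<bar> \<le> y}"
    by (rule measure_pmf.finite_measure_mono_AE) (auto simp: AE_measure_pmf_iff dest: length_coins)
  ultimately show ?thesis by simp
qed

text \<open>
  Toss instead the coin \<open>q = p + u\<close> whose expected sum is \<open>(1 + \<eta>) x\<close>.  By Chebyshev's inequality its sum lies
  within \<open>\<eta> x\<close> of that value with probability at least \<open>1 / 2\<close>, and on this event the change back to the
  \<open>p\<close>-coin costs no more than a factor \<open>exp (- (1 + 15 \<eta>) X)\<close>, where \<open>X\<close> is the Gaussian exponent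
  \<open>x\<^sup>2 / (2 n p (1 - p) c\<^sup>2)\<close>.  The condition \<open>K n \<le> x\<^sup>2\<close> serves Chebyshev's inequality and lets \<open>exp (- \<eta> X)\<close> absorb the
  factor \<open>1 / 2\<close>; the condition \<open>x \<le> \<kappa> n\<close> keeps \<open>u\<close> small.
\<close>

proposition coins_lower_tail:
  assumes p: "0 < p" "p < 1" and "c \<noteq> 0" and "\<delta> > 0"
  obtains \<kappa> K where "\<kappa> > 0"
    "\<And>n x. 0 < x \<Longrightarrow> K * real n \<le> x\<^sup>2 \<Longrightarrow> x \<le> \<kappa> * real n \<Longrightarrow>
       exp (- ((1 + \<delta>) * x\<^sup>2 / (2 * n * (p * (1 - p) * c\<^sup>2))))
       \<le> measure_pmf.prob (coins p n) {w. x \<le> c * excess p w}"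
proof -
  \<comment> \<open>The total relative error below is 16 \<eta>: at most 15 \<eta> from the change of coin, \<eta> from the factor 1 / 2.\<close>
  define \<eta> where "\<eta> = min 1 (\<delta> / 16)"
  have \<eta>: "0 < \<eta>" "\<eta> \<le> 1" "16 * \<eta> \<le> \<delta>" using \<open>\<delta> > 0\<close> by (auto simp: \<eta>_def)
  define V where "V = p * (1 - p)"
  have V: "V > 0" using p by (simp add: V_def)
  obtain r where r: "r > 0" and
    kl: "\<And>u. \<bar>u\<bar> \<le> r \<Longrightarrow> kl_divergence (p + u) p \<le> (1 + \<eta>) * u\<^sup>2 / (2 * V)" and
    lo: "\<And>u. \<bar>u\<bar> \<le> r \<Longrightarrow> \<bar>log_odds_ratio (p + u) p\<bar> \<le> (1 + \<eta>) * \<bar>u\<bar> / V"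
    using kl_divergence_le[OF p \<eta>(1)] unfolding V_def by metis
  \<comment> \<open>Besides the expansions, q = p + u must remain strictly between 0 and 1.\<close>
  define r' where "r' = min r (min p (1 - p) / 2)"
  have r': "r' > 0" "r' \<le> r" "r' < p" "r' < 1 - p" using r p by (auto simp: r'_def min_def)
  define \<kappa> where "\<kappa> = r' * \<bar>c\<bar> / (1 + \<eta>)"
  define K where "K = c\<^sup>2 / \<eta>\<^sup>2 + 2 * (V * c\<^sup>2) / \<eta>"
  show thesis
  proof (rule that[of \<kappa> K], goal_cases)
    case 1
    show ?case using r' \<eta> \<open>c \<noteq> 0\<close> by (simp add: \<kappa>_def)
  next
    case (2 n x)
    have n: "n > 0" using 2 by (cases "n = 0") auto
    define u where "u = (1 + \<eta>) * x / (n * c)"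
    define q where "q = p + u"
    define y where "y = \<eta> * x / \<bar>c\<bar>"
    have y: "y > 0" using \<eta> 2 \<open>c \<noteq> 0\<close> by (simp add: y_def)
    have abs_u: "\<bar>u\<bar> = (1 + \<eta>) * x / (n * \<bar>c\<bar>)" 
      using \<eta> 2 by (simp add: u_def abs_mult)
    have u: "\<bar>u\<bar> \<le> r'"
      using 2(3) \<eta> n \<open>c \<noteq> 0\<close> unfolding abs_u by (simp add: \<kappa>_def field_simps)
    have q: "0 < q" "q < 1" using u r' by (auto simp: q_def)
    define A where "A = {w. length w = n \<and> \<bar>excess q w\<bar> \<le> y}"
    define X where "X = x\<^sup>2 / (2 * n * (V * c\<^sup>2))"
    have X0: "X \<ge> 0" using V by (simp add: X_def)
    have "K * n = c\<^sup>2 / \<eta>\<^sup>2 * n + 2 * (V * c\<^sup>2) / \<eta> * n" by (simp only: K_def distrib_right)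
    moreover have "c\<^sup>2 / \<eta>\<^sup>2 * n \<ge> 0" "2 * (V * c\<^sup>2) / \<eta> * n \<ge> 0" using V \<eta> by auto
    ultimately have K1: "c\<^sup>2 / \<eta>\<^sup>2 * n \<le> x\<^sup>2" "2 * (V * c\<^sup>2) / \<eta> * n \<le> x\<^sup>2"
      using 2(2) by linarith+
    have half: "1 / 2 \<le> measure_pmf.prob (coins q n) A"
      unfolding A_def
    proof (rule chebyshev_coins)
      have "real n \<le> y\<^sup>2" using K1(1) \<eta> \<open>c \<noteq> 0\<close> by (simp add: y_def field_simps)
      also have "\<dots> \<le> 2 * y\<^sup>2" by simp
      finally show "real n \<le> 2 * y\<^sup>2" .
    qed (use q y in auto)
    have exp_half: "exp (- (\<eta> * X)) \<le> 1 / 2"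
    proof -
      have "1 \<le> \<eta> * X"
        using K1(2) V \<eta> n \<open>c \<noteq> 0\<close> by (simp add: X_def field_simps)
      then have "2 \<le> exp (\<eta> * X)" using exp_ge_add_one_self[of "\<eta> * X"] by linarith
      then show ?thesis by (simp add: exp_minus field_simps)
    qed
    have cost: "n * kl_divergence q p + y * \<bar>log_odds_ratio q p\<bar> \<le> (1 + 15 * \<eta>) * X"
    proof -
      have "n * kl_divergence q p + y * \<bar>log_odds_ratio q p\<bar>
          \<le> n * ((1 + \<eta>) * u\<^sup>2 / (2 * V)) + y * ((1 + \<eta>) * \<bar>u\<bar> / V)"
        unfolding q_def using u r' y by (intro add_mono mult_left_mono kl lo) auto
      also have "n * ((1 + \<eta>) * u\<^sup>2 / (2 * V)) = (1 + \<eta>) ^ 3 * X"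
        using n V \<open>c \<noteq> 0\<close> by (simp add: u_def X_def field_simps power2_eq_square power3_eq_cube)
      also have "y * ((1 + \<eta>) * \<bar>u\<bar> / V) = 2 * \<eta> * (1 + \<eta>)\<^sup>2 * X"
      proof -
        define b where "b = \<bar>c\<bar>"
        have b: "b > 0" "c\<^sup>2 = b\<^sup>2" using \<open>c \<noteq> 0\<close> by (auto simp: b_def)
        show ?thesis
          unfolding abs_u X_def y_def b(2) b_def[symmetric] using n V b(1)
          by (simp add: field_simps power2_eq_square)
      qed
      also have "(1 + \<eta>) ^ 3 * X + 2 * \<eta> * (1 + \<eta>)\<^sup>2 * X = (1 + 5 * \<eta> + 7 * \<eta>\<^sup>2 + 3 * \<eta> ^ 3) * X"
        by (simp add: algebra_simps power2_eq_square power3_eq_cube)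
      also have "\<dots> \<le> (1 + 15 * \<eta>) * X"
      proof (intro mult_right_mono X0)
        have "\<eta>\<^sup>2 \<le> \<eta>" "\<eta> ^ 3 \<le> \<eta>"
          using \<eta> power_decreasing[of 1 2 \<eta>] power_decreasing[of 1 3 \<eta>] by auto
        then show "1 + 5 * \<eta> + 7 * \<eta>\<^sup>2 + 3 * \<eta> ^ 3 \<le> 1 + 15 * \<eta>" by linarith
      qed
      finally show ?thesis .
    qed
    have "exp (- ((1 + \<delta>) * X)) \<le> exp (- ((1 + 15 * \<eta>) * X)) * exp (- (\<eta> * X))"
    proof -
      have "(1 + 16 * \<eta>) * X \<le> (1 + \<delta>) * X" using \<eta> X0 by (intro mult_right_mono) auto
      then show ?thesis by (simp add: algebra_simps flip: exp_add)
    qed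
    also have "\<dots> \<le> exp (- (n * kl_divergence q p + y * \<bar>log_odds_ratio q p\<bar>)) * measure_pmf.prob (coins q n) A"
      using cost half exp_half by (intro mult_mono) auto
    also have "\<dots> \<le> measure_pmf.prob (coins p n) A"
      by (rule prob_coins_ge_tilted) (use p q in \<open>auto simp: A_def\<close>)
    also have "\<dots> \<le> measure_pmf.prob (coins p n) {w. x \<le> c * excess p w}"
    proof (rule measure_pmf.finite_measure_mono)
      show "A \<subseteq> {w. x \<le> c * excess p w}"
      proof safe
        fix w assume w: "w \<in> A"
        have "\<bar>c * excess q w\<bar> \<le> \<bar>c\<bar> * y"
          using w by (simp add: A_def abs_mult mult_left_mono)
        also have "\<dots> = \<eta> * x" using \<open>c \<noteq> 0\<close> by (simp add: y_def)
        finally have "- (\<eta> * x) \<le> c * excess q w" by linarith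
        moreover have "c * (n * (q - p)) = (1 + \<eta>) * x"
          using n \<open>c \<noteq> 0\<close> by (simp add: q_def u_def)
        moreover have "excess p w = excess q w + n * (q - p)"
          using w excess_change[of p w q] by (simp add: A_def)
        ultimately show "x \<le> c * excess p w" by (simp only: distrib_left) (simp add: algebra_simps)
      qed
    qed simp
    finally show ?case by (simp add: X_def V_def)
  qed
qed

section \<open>The law of the iterated logarithm\<close>

definition lil_scale :: "real \<Rightarrow> real" where
  "lil_scale t = sqrt (2 * t * ln (ln t))"

text \<open>
  From \<open>t = 3 > exp 1\<close> on, the iterated logarithm is nonnegative, so the square root is taken of
  a nonnegative number.
\<close>

lemma lil_scale_nonneg: "3 \<le> t \<Longrightarrow> 0 \<le> lil_scale t"
  and lil_scale_mono: "3 \<le> t \<Longrightarrow> t \<le> t' \<Longrightarrow> lil_scale t \<le> lil_scale t'"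
proof -
  have "1 \<le> ln t" if "3 \<le> t" for t :: real
    using that exp_le by (subst ln_ge_iff) auto
  then show "3 \<le> t \<Longrightarrow> 0 \<le> lil_scale t" "3 \<le> t \<Longrightarrow> t \<le> t' \<Longrightarrow> lil_scale t \<le> lil_scale t'"
    unfolding lil_scale_def
    by (auto intro!: mult_mono simp: ln_mono)
qed

lemma lil_scale_square: "3 \<le> t \<Longrightarrow> (lil_scale t)\<^sup>2 = 2 * t * ln (ln t)"
  using lil_scale_nonneg[of t] by (simp add: lil_scale_def)

lemma lil_scale_sublinear: "((\<lambda>t. lil_scale t / t) \<longlongrightarrow> 0) at_top"
  unfolding lil_scale_def by real_asymp

lemma filterlim_power_at_top: "1 < (x::real) \<Longrightarrow> filterlim (\<lambda>k. x ^ k) at_top sequentially"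
  by real_asymp

lemma filterlim_lil_scale: "filterlim lil_scale at_top at_top"
  unfolding lil_scale_def by real_asymp

lemma geometric_subsequence:
  fixes \<theta> :: real
  assumes "\<theta> > 1"
  shows "\<exists>n0. \<forall>n\<ge>n0. \<exists>k\<ge>k0. nat \<lceil>\<theta> ^ k\<rceil> \<le> n \<and> n \<le> nat \<lceil>\<theta> ^ Suc k\<rceil>"
proof (rule exI[of _ "nat \<lceil>\<theta> ^ k0\<rceil>"], intro allI impI)
  fix n assume n: "nat \<lceil>\<theta> ^ k0\<rceil> \<le> n"
  obtain m where "real n < \<theta> ^ m" using real_arch_pow[OF assms] by blast
  then have m: "n \<le> nat \<lceil>\<theta> ^ m\<rceil>" by linarith
  define k where "k = (GREATEST k. nat \<lceil>\<theta> ^ k\<rceil> \<le> n)"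
  obtain m' where m': "real n < \<theta> ^ m'" using real_arch_pow[OF assms] by blast
  have bnd: "k \<le> m'" if "nat \<lceil>\<theta> ^ k\<rceil> \<le> n" for k
  proof (rule ccontr)
    assume "\<not> k \<le> m'"
    then have "\<theta> ^ m' \<le> \<theta> ^ k" using assms by (intro power_increasing) auto
    then show False using that m' by linarith
  qed
  have "nat \<lceil>\<theta> ^ k\<rceil> \<le> n"
    unfolding k_def by (rule GreatestI_nat[where P = "\<lambda>k. nat \<lceil>\<theta> ^ k\<rceil> \<le> n", OF n bnd])
  moreover have "k0 \<le> k"
    unfolding k_def by (rule Greatest_le_nat[where P = "\<lambda>k. nat \<lceil>\<theta> ^ k\<rceil> \<le> n", OF n bnd])
  moreover have "\<not> nat \<lceil>\<theta> ^ Suc k\<rceil> \<le> n"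
    using Greatest_le_nat[of "\<lambda>k. nat \<lceil>\<theta> ^ k\<rceil> \<le> n" "Suc k" m'] bnd unfolding k_def by auto
  ultimately show "\<exists>k\<ge>k0. nat \<lceil>\<theta> ^ k\<rceil> \<le> n \<and> n \<le> nat \<lceil>\<theta> ^ Suc k\<rceil>"
    by (intro exI[of _ k]) linarith
qed

text \<open>
  The positions \<open>N k\<close> cut a word into consecutive blocks, and each further block is independent of the
  word before it (\<open>prob_coins_append\<close>).
\<close>

lemma prob_coins_blocks:
  assumes "mono N"
  shows "K \<le> L \<Longrightarrow>
    measure_pmf.prob (coins p (N L)) {w. \<forall>k\<in>{K..<L}. drop (N k) (take (N (Suc k)) w) \<notin> G k}
    = (\<Prod>k\<in>{K..<L}. 1 - measure_pmf.prob (coins p (N (Suc k) - N k)) (G k))"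
proof (induction L rule: dec_induct)
  case base
  then show ?case by simp
next
  case (step L)
  let ?A = "{w. \<forall>k\<in>{K..<L}. drop (N k) (take (N (Suc k)) w) \<notin> G k}"
  have N: "N L \<le> N (Suc L)" "\<And>k. k < L \<Longrightarrow> N (Suc k) \<le> N L"
    using assms by (auto simp: mono_def)
  have len: "N (Suc L) = N L + (N (Suc L) - N L)" using N(1) by simp
  have "measure_pmf.prob (coins p (N (Suc L)))
      {w. \<forall>k\<in>{K..<Suc L}. drop (N k) (take (N (Suc k)) w) \<notin> G k}
    = measure_pmf.prob (coins p (N (Suc L))) {w. take (N L) w \<in> ?A \<and> drop (N L) w \<in> - G L}"
  proof (rule measure_pmf.finite_measure_eq_AE, unfold AE_measure_pmf_iff, rule ballI)
    fix w assume "w \<in> set_pmf (coins p (N (Suc L)))"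
    then have "length w = N (Suc L)" by (rule length_coins)
    then show "w \<in> {w. \<forall>k\<in>{K..<Suc L}. drop (N k) (take (N (Suc k)) w) \<notin> G k} \<longleftrightarrow>
        w \<in> {w. take (N L) w \<in> ?A \<and> drop (N L) w \<in> - G L}"
      using step.hyps(1) N by (auto simp: min_absorb1 atLeastLessThanSuc)
  qed simp_all
  also have "\<dots> = measure_pmf.prob (coins p (N L)) ?A * measure_pmf.prob (coins p (N (Suc L) - N L)) (- G L)"
    by (subst len) (rule prob_coins_append)
  also have "measure_pmf.prob (coins p (N (Suc L) - N L)) (- G L)
      = 1 - measure_pmf.prob (coins p (N (Suc L) - N L)) (G L)"
    using measure_pmf.prob_compl[of "G L" "coins p (N (Suc L) - N L)"] by (simp add: Compl_eq_Diff_UNIV)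
  finally show ?case
    using step by (simp add: prod.atLeastLessThan_Suc)
qed

text \<open>
  Only the laws of the finite initial words are prescribed.  This is enough for the strong limit
  theorems below and is what a Bernoulli product provides directly.
\<close>

locale coin_process = prob_space M for M :: "'a measure" +
  fixes p :: real and X :: "nat \<Rightarrow> 'a \<Rightarrow> bool"
  assumes p: "0 < p" "p < 1"
    and outcomes_measurable [measurable]:
      "\<And>n. (\<lambda>x. map (\<lambda>i. X i x) [0..<n]) \<in> measurable M (count_space UNIV)"
    and distr_outcomes:
      "\<And>n. distr M (count_space UNIV) (\<lambda>x. map (\<lambda>i. X i x) [0..<n]) = measure_pmf (coins p n)"
begin

definition outcomes :: "nat \<Rightarrow> 'a \<Rightarrow> bool list" where
  "outcomes n x = map (\<lambda>i. X i x) [0..<n]"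

lemma measurable_outcomes [measurable]: "outcomes n \<in> measurable M (count_space UNIV)"
  unfolding outcomes_def by measurable

lemma length_outcomes [simp]: "length (outcomes n x) = n"
  by (simp add: outcomes_def)

lemma take_outcomes: "k \<le> n \<Longrightarrow> take k (outcomes n x) = outcomes k x"
  by (simp add: outcomes_def take_map)

lemma sets_outcomes [measurable]: "{x \<in> space M. outcomes n x \<in> A} \<in> sets M"
  by measurable

lemma prob_outcomes: "prob {x \<in> space M. outcomes n x \<in> A} = measure_pmf.prob (coins p n) A"
proof -
  have "measure_pmf.prob (coins p n) A = measure (distr M (count_space UNIV) (outcomes n)) A"
    using distr_outcomes[of n] by (simp add: outcomes_def[abs_def])
  also have "\<dots> = prob (outcomes n -` A \<inter> space M)"
    by (subst measure_distr) auto
  also have "outcomes n -` A \<inter> space M = {x \<in> space M. outcomes n x \<in> A}" by auto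
  finally show ?thesis ..
qed

text \<open>
  Let \<open>N k\<close> grow like \<open>\<theta> ^ k\<close>.  If the maximum of the sums up to time \<open>N (Suc k)\<close> stays below \<open>s\<close> times the
  scale at time \<open>N k\<close> for all large \<open>k\<close>, then the bound holds at all large times between.  With \<open>a ^ 4 = (s / \<sigma>)\<^sup>2\<close>
  and \<open>\<theta> = sqrt a\<close>, the upper tail estimate loses one factor \<open>a\<close> for its error \<open>\<delta> = a - 1\<close> and one for
  \<open>N (Suc k) / N k\<close>, and keeps the exponent \<open>a\<^sup>2 > 1\<close>: the exceptional probabilities are at most of order
  \<open>k powr - a\<^sup>2\<close>, hence summable.
\<close>

theorem lil_upper:
  assumes "\<sigma> > 0" "\<sigma>\<^sup>2 = p * (1 - p) * c\<^sup>2" "s > \<sigma>"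
  shows "AE x in M. \<forall>\<^sub>F n in sequentially. c * excess p (outcomes n x) \<le> s * lil_scale n"
proof -
  have c: "c \<noteq> 0" using assms by auto
  define a where "a = root 4 ((s / \<sigma>)\<^sup>2)"
  have "(s / \<sigma>)\<^sup>2 > 1" using assms by simp
  then have a: "a > 1" by (simp add: a_def)
  have a4: "a ^ 4 = (s / \<sigma>)\<^sup>2" using assms by (simp add: a_def)
  define \<theta> where "\<theta> = sqrt a"
  have \<theta>: "\<theta> > 1" "\<theta>\<^sup>2 = a" using a by (auto simp: \<theta>_def)
  obtain \<kappa> where \<kappa>: "\<kappa> > 0" and
    tail: "\<And>n x. 0 \<le> x \<Longrightarrow> x \<le> \<kappa> * real n \<Longrightarrow>
       measure_pmf.prob (coins p n) {w. \<exists>k\<le>n. x \<le> c * excess p (take k w)}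
       \<le> exp (- x\<^sup>2 / (2 * n * ((1 + (a - 1)) * (p * (1 - p) * c\<^sup>2))))"
    using coins_upper_tail[OF p c, of "a - 1"] a by auto
  define N where "N k = nat \<lceil>\<theta> ^ k\<rceil>" for k
  have N_ge: "\<theta> ^ k \<le> N k" for k unfolding N_def by linarith
  have N_mono: "N k \<le> N (Suc k)" for k
    unfolding N_def using \<theta> by (intro nat_mono ceiling_mono power_increasing) auto
  have N_top: "filterlim (\<lambda>k. real (N k)) at_top sequentially"
    by (rule filterlim_at_top_mono[OF filterlim_power_at_top[of \<theta>]])
       (use \<theta> N_ge in auto)
  define B where "B k = {x \<in> space M. outcomes (N (Suc k)) x \<in>
      {w. \<exists>j\<le>N (Suc k). s * lil_scale (N k) \<le> c * excess p (take j w)}}" for k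
  have B_sets: "B k \<in> sets M" for k unfolding B_def by measurable
  have prob_B: "\<forall>\<^sub>F k in sequentially. prob (B k) \<le> (ln \<theta> * real k) powr - (a\<^sup>2)"
  proof -
    have "\<forall>\<^sub>F k in sequentially. 3 \<le> real (N k)"
      using N_top unfolding filterlim_at_top by blast
    moreover have "\<forall>\<^sub>F k in sequentially. lil_scale (N k) / N k < \<kappa> / s"
      using filterlim_compose[OF lil_scale_sublinear N_top] \<kappa> assms
      by (intro order_tendstoD(2)) auto
    \<comment> \<open>This absorbs the rounding in N (Suc k), so that N (Suc k) \<le> a N k.\<close>
    moreover have "\<forall>\<^sub>F k in sequentially. 1 / (a - \<theta>) \<le> \<theta> ^ k"
      using filterlim_power_at_top[of \<theta>] \<theta> by (simp add: filterlim_at_top)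
    moreover have "\<forall>\<^sub>F k in sequentially. 0 < k" by (rule eventually_gt_at_top)
    ultimately show ?thesis
    proof eventually_elim
      case (elim k)
      have pos: "N k > 0" "N (Suc k) > 0" using elim(1) N_mono[of k] by auto
      have ratio: "N (Suc k) \<le> a * N k"
      proof -
        have "\<theta> * 1 < \<theta> * \<theta>" using \<theta>(1) by (intro mult_strict_left_mono) auto
        then have "\<theta> < a" using \<theta>(2) by (simp add: power2_eq_square)
        then have "1 \<le> \<theta> ^ k * (a - \<theta>)" using elim(3) by (simp add: field_simps)
        then have "\<theta> ^ Suc k + 1 \<le> a * \<theta> ^ k" by (simp add: algebra_simps)
        moreover have "N (Suc k) \<le> \<theta> ^ Suc k + 1" unfolding N_def using \<theta> by simp
        moreover have "a * \<theta> ^ k \<le> a * N k" using N_ge[of k] a by simp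
        ultimately show ?thesis by linarith
      qed
      have x0: "0 \<le> s * lil_scale (N k)" using elim(1) assms lil_scale_nonneg by simp
      have xk: "s * lil_scale (N k) \<le> \<kappa> * N (Suc k)"
      proof -
        have "s * lil_scale (N k) \<le> \<kappa> * N k" using elim(2) pos assms by (simp add: field_simps)
        also have "\<dots> \<le> \<kappa> * N (Suc k)" using \<kappa> N_mono[of k] by simp
        finally show ?thesis .
      qed
      have lnN: "ln (ln \<theta> * k) \<le> ln (ln (N k))"
      proof -
        have "ln \<theta> * k = ln (\<theta> ^ k)" using \<theta> by (simp add: ln_realpow)
        also have "\<dots> \<le> ln (N k)" using N_ge[of k] \<theta> by (intro ln_mono) auto
        finally show ?thesis using \<theta> elim(4) by (intro ln_mono) auto
      qed
      have "prob (B k) \<le> exp (- (s * lil_scale (N k))\<^sup>2 / (2 * real (N (Suc k)) * ((1 + (a - 1)) * (p * (1 - p) * c\<^sup>2))))"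
        unfolding B_def prob_outcomes by (rule tail[OF x0 xk])
      also have "\<dots> \<le> exp (- (a\<^sup>2) * ln (ln \<theta> * k))"
      proof -
        have "a\<^sup>2 * ln (ln \<theta> * k) \<le> (s * lil_scale (N k))\<^sup>2 / (2 * real (N (Suc k)) * (a * \<sigma>\<^sup>2))"
        proof (cases "ln (ln \<theta> * k) \<le> 0")
          case True
          then have "a\<^sup>2 * ln (ln \<theta> * k) \<le> 0" by (simp add: mult_nonneg_nonpos)
          also have "0 \<le> (s * lil_scale (N k))\<^sup>2 / (2 * real (N (Suc k)) * (a * \<sigma>\<^sup>2))" using a by simp
          finally show ?thesis .
        next
          case False
          have "a\<^sup>2 * ln (ln \<theta> * k) \<le> a\<^sup>2 * ln (ln (N k))" using lnN by (simp add: mult_left_mono)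
          also have "\<dots> = (s * lil_scale (N k))\<^sup>2 / (2 * (a * real (N k)) * (a * \<sigma>\<^sup>2))"
          proof -
            have s2: "s\<^sup>2 = a ^ 4 * \<sigma>\<^sup>2" using a4 \<open>\<sigma> > 0\<close> by (simp add: power_divide)
            have "a ^ 4 = a\<^sup>2 * (a * a)" by (simp add: power4_eq_xxxx power2_eq_square)
            then show ?thesis
              using a \<open>\<sigma> > 0\<close> pos by (simp add: power_mult_distrib lil_scale_square[OF elim(1)] s2)
          qed
          also have "\<dots> \<le> (s * lil_scale (N k))\<^sup>2 / (2 * real (N (Suc k)) * (a * \<sigma>\<^sup>2))"
            using ratio a \<open>\<sigma> > 0\<close> pos by (intro divide_left_mono mult_right_mono mult_left_mono mult_pos_pos) auto
          finally show ?thesis .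
        qed
        then show ?thesis by (simp add: assms(2))
      qed
      also have "\<dots> = (ln \<theta> * real k) powr - (a\<^sup>2)"
        using \<theta> elim(4) by (simp add: powr_def)
      finally show ?case .
    qed
  qed
  have "summable (\<lambda>k. prob (B k))"
  proof (rule summable_comparison_test_ev)
    show "\<forall>\<^sub>F k in sequentially. norm (prob (B k)) \<le> (ln \<theta> * real k) powr - (a\<^sup>2)"
      using prob_B by simp
    have "summable (\<lambda>k. ln \<theta> powr - (a\<^sup>2) * real k powr - (a\<^sup>2))"
      using a by (intro summable_mult) (simp add: summable_real_powr_iff)
    then show "summable (\<lambda>k. (ln \<theta> * real k) powr - (a\<^sup>2))"
      using \<theta> by (simp add: powr_mult)
  qed
  then have "AE x in M. \<forall>\<^sub>F k in sequentially. x \<in> space M - B k"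
    by (intro borel_cantelli_AE1) (auto simp: B_sets less_top[symmetric])
  moreover have "\<forall>\<^sub>F k in sequentially. 3 \<le> real (N k)"
    using N_top unfolding filterlim_at_top by blast
  ultimately show ?thesis
  proof (elim AE_mp, intro AE_I2 impI)
    fix x assume ev: "\<forall>\<^sub>F k in sequentially. 3 \<le> real (N k)"
      and "x \<in> space M" "\<forall>\<^sub>F k in sequentially. x \<in> space M - B k"
    then have "\<forall>\<^sub>F k in sequentially. x \<notin> B k \<and> 3 \<le> real (N k)"
      by (auto elim: eventually_elim2)
    then obtain k0 where k0: "\<And>k. k \<ge> k0 \<Longrightarrow> x \<notin> B k \<and> 3 \<le> real (N k)"
      by (auto simp: eventually_sequentially)
    obtain n0 where n0: "\<And>n. n \<ge> n0 \<Longrightarrow> \<exists>k\<ge>k0. N k \<le> n \<and> n \<le> N (Suc k)"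
      using geometric_subsequence[OF \<theta>(1), of k0] unfolding N_def by blast
    show "\<forall>\<^sub>F n in sequentially. c * excess p (outcomes n x) \<le> s * lil_scale n"
      unfolding eventually_sequentially
    proof (intro exI[of _ n0] allI impI)
      fix n assume "n \<ge> n0"
      then obtain k where k: "k \<ge> k0" "N k \<le> n" "n \<le> N (Suc k)" using n0 by blast
      then have "\<not> s * lil_scale (N k) \<le> c * excess p (take n (outcomes (N (Suc k)) x))"
        using k0[of k] \<open>x \<in> space M\<close> by (auto simp: B_def)
      moreover have "lil_scale (N k) \<le> lil_scale n"
        using k0[of k] k by (intro lil_scale_mono) auto
      then have "s * lil_scale (N k) \<le> s * lil_scale n" using assms by simp
      ultimately show "c * excess p (outcomes n x) \<le> s * lil_scale n"
        using k by (simp add: take_outcomes)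
    qed
  qed
qed
text \<open>
  The second Borel-Cantelli lemma for events of disjoint blocks: the probability that no block after the
  \<open>K\<close>-th succeeds is at most the exponential of minus a divergent sum.
\<close>

lemma blocks_infinitely_often:
  assumes "mono N"
    and div: "\<not> summable (\<lambda>k. measure_pmf.prob (coins p (N (Suc k) - N k)) (G k))"
  shows "AE x in M. \<exists>\<^sub>F k in sequentially. drop (N k) (outcomes (N (Suc k)) x) \<in> G k"
proof -
  define g where "g k = measure_pmf.prob (coins p (N (Suc k) - N k)) (G k)" for k
  define Z where "Z K = {x \<in> space M. \<forall>k\<ge>K. drop (N k) (outcomes (N (Suc k)) x) \<notin> G k}" for K
  have Z_sets: "Z K \<in> sets M" for K
    unfolding Z_def by measurable
  have "prob (Z K) = 0" for K
  proof -
    have le: "prob (Z K) \<le> exp (- (\<Sum>k\<in>{K..<L}. g k))" if "K \<le> L" for L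
    proof -
      have "prob (Z K) \<le> prob {x \<in> space M. outcomes (N L) x \<in>
          {w. \<forall>k\<in>{K..<L}. drop (N k) (take (N (Suc k)) w) \<notin> G k}}"
      proof (rule finite_measure_mono)
        have "N (Suc k) \<le> N L" if "k < L" for k using that assms(1) by (auto simp: mono_def)
        then show "Z K \<subseteq> {x \<in> space M. outcomes (N L) x \<in>
            {w. \<forall>k\<in>{K..<L}. drop (N k) (take (N (Suc k)) w) \<notin> G k}}"
          by (auto simp: Z_def take_outcomes)
      qed (rule sets_outcomes)
      also have "\<dots> = (\<Prod>k\<in>{K..<L}. 1 - g k)"
        unfolding prob_outcomes g_def by (rule prob_coins_blocks[OF assms(1) that])
      also have "\<dots> \<le> (\<Prod>k\<in>{K..<L}. exp (- g k))"
      proof (rule prod_mono)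
        fix k
        show "0 \<le> 1 - g k \<and> 1 - g k \<le> exp (- g k)"
          using exp_ge_add_one_self[of "- g k"] by (simp add: g_def)
      qed
      also have "\<dots> = exp (- (\<Sum>k\<in>{K..<L}. g k))"
        by (simp add: exp_sum flip: sum_negf)
      finally show ?thesis .
    qed
    show ?thesis
    proof (rule ccontr)
      assume "prob (Z K) \<noteq> 0"
      then have pos: "prob (Z K) > 0" by (simp add: zero_less_measure_iff)
      have "summable (\<lambda>k. g (k + K))"
      proof (rule summableI_nonneg_bounded)
        fix n
        have "(\<Sum>k<n. g (k + K)) = (\<Sum>k\<in>{K..<n + K}. g k)"
          using sum.shift_bounds_nat_ivl[of g 0 K n] by (simp add: lessThan_atLeast0)
        moreover have "prob (Z K) \<le> exp (- (\<Sum>k\<in>{K..<n + K}. g k))" by (rule le) simp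
        then have "ln (prob (Z K)) \<le> - (\<Sum>k\<in>{K..<n + K}. g k)"
          using pos ln_le_cancel_iff[OF pos exp_gt_zero] by simp
        ultimately show "(\<Sum>k<n. g (k + K)) \<le> - ln (prob (Z K))" by linarith
      qed (simp add: g_def)
      then have "summable g" by (subst (asm) summable_iff_shift)
      with div show False by (simp add: g_def[abs_def])
    qed
  qed
  then have "AE x in M. x \<notin> Z K" for K
    using Z_sets by (intro AE_I[of _ _ "Z K"]) (auto simp: emeasure_eq_measure)
  then have "AE x in M. \<forall>K. x \<notin> Z K" by (simp add: AE_all_countable)
  then show ?thesis
    by (rule AE_mp) (auto intro!: AE_I2 simp: Z_def frequently_sequentially)
qed

text \<open>
  Take the times \<open>N k = b ^ k\<close> for a large integer \<open>b\<close>, and a level \<open>s1\<close> strictly between \<open>s\<close> and \<open>\<sigma>\<close>.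
  By the lower tail estimate, the block of tosses from \<open>N k\<close> to \<open>N (Suc k)\<close> contributes at least \<open>s1\<close> times the
  scale at \<open>N (Suc k)\<close> with probability at least \<open>1 / ((k + 1) ln b)\<close>, which is not summable, so this happens
  infinitely often.  The tosses before \<open>N k\<close> cannot spoil it: by \<open>lil_upper\<close> for \<open>- c\<close> their sum is eventually
  at least \<open>- 2 \<sigma>\<close> times the scale at \<open>N k\<close>, which is at most \<open>1 / sqrt b\<close> times that at \<open>N (Suc k)\<close>.
\<close>

theorem lil_lower:
  assumes \<sigma>: "\<sigma> > 0" "\<sigma>\<^sup>2 = p * (1 - p) * c\<^sup>2" and "s < \<sigma>"
  shows "AE x in M. \<exists>\<^sub>F n in sequentially. s * lil_scale n \<le> c * excess p (outcomes n x)"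
proof -
  have c: "c \<noteq> 0" using \<sigma> by auto
  define s1 where "s1 = (max s 0 + \<sigma>) / 2"
  have s1: "0 < s1" "s1 < \<sigma>" "s < s1" using \<sigma> \<open>s < \<sigma>\<close> by (auto simp: s1_def)
  \<comment> \<open>The squared ratio (s1 / \<sigma>)^2 is spent as one factor s1 / \<sigma> on the tail error 1 + \<delta>, one on b / (b - 1).\<close>
  define \<delta> where "\<delta> = \<sigma> / s1 - 1"
  have \<delta>: "\<delta> > 0" "1 + \<delta> = \<sigma> / s1" using s1 by (auto simp: \<delta>_def)
  obtain \<kappa> K where \<kappa>: "\<kappa> > 0" and
    tail: "\<And>n x. 0 < x \<Longrightarrow> K * real n \<le> x\<^sup>2 \<Longrightarrow> x \<le> \<kappa> * real n \<Longrightarrow>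
       exp (- ((1 + \<delta>) * x\<^sup>2 / (2 * n * (p * (1 - p) * c\<^sup>2))))
       \<le> measure_pmf.prob (coins p n) {w. x \<le> c * excess p w}"
    using coins_lower_tail[OF p c \<delta>(1)] by blast
  \<comment> \<open>The last two bounds give the facts b_ratio (block length against N (Suc k)) and b_past (influence of the past).\<close>
  obtain b :: nat where b: "real b > max (max 2 (1 / (1 - s1 / \<sigma>))) ((2 * \<sigma> / (s1 - s))\<^sup>2)"
    using reals_Archimedean2 by blast
  have b2: "b > 2" using b by simp
  have b_ratio: "s1 / \<sigma> * real b \<le> real b - 1"
  proof -
    have "1 < real b * (1 - s1 / \<sigma>)" using b s1 \<sigma> by (simp add: pos_divide_less_eq)
    then show ?thesis by (simp add: algebra_simps)
  qed
  have b_past: "2 * \<sigma> \<le> (s1 - s) * sqrt b"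
  proof -
    have "2 * \<sigma> / (s1 - s) < sqrt b" using b by (intro real_less_rsqrt) auto
    then show ?thesis using s1 by (simp add: field_simps)
  qed
  define N where "N k = b ^ k" for k
  have mono_N: "mono N" unfolding N_def mono_def using b2 by (auto intro: power_increasing)
  have N_top: "filterlim (\<lambda>k. real (N k)) at_top sequentially"
    unfolding N_def using filterlim_power_at_top[of "real b"] b2 by simp
  have N_top': "filterlim (\<lambda>k. real (N (Suc k))) at_top sequentially"
    by (rule filterlim_compose[OF N_top filterlim_Suc])
  define len where "len k = N (Suc k) - N k" for k
  have len: "real (len k) = (real b - 1) * real (N k)" "real (N (Suc k)) = real b * real (N k)" for k
  proof -
    have "N k \<le> N (Suc k)" using mono_N by (simp add: mono_def)
    then show "real (len k) = (real b - 1) * real (N k)" "real (N (Suc k)) = real b * real (N k)"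
      by (simp_all add: len_def of_nat_diff N_def algebra_simps)
  qed
  have len_le: "real (len k) \<le> real (N (Suc k))" "real (N (Suc k)) \<le> 2 * real (len k)" for k
    using b2 by (auto simp: len intro!: mult_right_mono simp flip: mult.assoc)
  define G where "G k = {w. s1 * lil_scale (N (Suc k)) \<le> c * excess p w}" for k
  have large: "\<forall>\<^sub>F k in sequentially. 3 \<le> real (N k)" "\<forall>\<^sub>F k in sequentially. 3 \<le> real (N (Suc k))"
    using N_top N_top' unfolding filterlim_at_top by blast+
  have prob_G: "\<forall>\<^sub>F k in sequentially.
      1 / (ln b * real (Suc k)) \<le> measure_pmf.prob (coins p (len k)) (G k)"
  proof -
    have "\<forall>\<^sub>F k in sequentially. lil_scale (N (Suc k)) / N (Suc k) < \<kappa> / (2 * s1)"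
      using filterlim_compose[OF lil_scale_sublinear N_top'] \<kappa> s1
      by (intro order_tendstoD(2)) auto
    moreover have "\<forall>\<^sub>F k in sequentially. max 1 (\<bar>K\<bar> / s1\<^sup>2) \<le> ln (ln (N (Suc k)))"
    proof -
      have "filterlim (\<lambda>t::real. ln (ln t)) at_top at_top" by real_asymp
      from filterlim_compose[OF this N_top'] show ?thesis
        unfolding filterlim_at_top by blast
    qed
    ultimately show ?thesis using large
    proof eventually_elim
      case (elim k)
      define T where "T = real (N (Suc k))"
      define x where "x = s1 * lil_scale T"
      have T: "T \<ge> 3" "ln (ln T) \<ge> 1" using elim by (auto simp: T_def)
      have x2: "x\<^sup>2 = s1\<^sup>2 * (2 * T * ln (ln T))"
        using lil_scale_square[OF T(1)] by (simp add: x_def power_mult_distrib)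
      have posT: "0 < 2 * T * ln (ln T)" using T by (intro mult_pos_pos) linarith+
      have pos: "0 < x"
        unfolding x_def lil_scale_def using s1 posT by (simp only: real_sqrt_gt_zero mult_pos_pos)
      have "K * len k \<le> \<bar>K\<bar> * T"
        using len_le(1)[of k] by (intro mult_mono) (auto simp: T_def)
      also have "\<bar>K\<bar> * T \<le> s1\<^sup>2 * ln (ln T) * T"
        using elim(2) s1 T by (intro mult_right_mono) (auto simp: T_def pos_divide_le_eq mult.commute)
      also have "\<dots> \<le> x\<^sup>2" using posT mult_left_mono[of 0 "T * ln (ln T)" "s1\<^sup>2"] by (simp add: x2 mult_ac)
      finally have xK: "K * len k \<le> x\<^sup>2" .
      have "x \<le> \<kappa> / 2 * T"
        using elim(1) T s1 by (simp add: x_def T_def field_simps)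
      also have "\<dots> \<le> \<kappa> * len k" using len_le(2)[of k] \<kappa> by (simp add: T_def)
      finally have xk: "x \<le> \<kappa> * len k" .
      have len_pos: "len k > 0" using len_le(2)[of k] T by (auto simp: T_def intro: ccontr)
      have "(1 + \<delta>) * x\<^sup>2 / (2 * len k * (p * (1 - p) * c\<^sup>2)) \<le> ln (ln T)"
      proof -
        have "(1 + \<delta>) * x\<^sup>2 = \<sigma> * s1 * T * (2 * ln (ln T))"
          unfolding \<delta> x2 using s1 by (simp add: power2_eq_square)
        also have "\<dots> \<le> \<sigma>\<^sup>2 * len k * (2 * ln (ln T))"
        proof -
          have "s1 / \<sigma> * T \<le> len k"
            using mult_right_mono[OF b_ratio, of "real (N k)"] by (simp add: T_def len)
          then have "\<sigma>\<^sup>2 * (s1 / \<sigma> * T) \<le> \<sigma>\<^sup>2 * len k" by (intro mult_left_mono) auto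
          then have "\<sigma> * s1 * T \<le> \<sigma>\<^sup>2 * len k" using \<sigma>(1) by (simp add: power2_eq_square)
          then show ?thesis using T(2) by (intro mult_right_mono) linarith+
        qed
        finally show ?thesis
          unfolding \<sigma>(2)[symmetric] using len_pos \<sigma>(1) by (simp add: divide_le_eq mult_ac)
      qed
      then have "exp (- ln (ln T)) \<le> exp (- ((1 + \<delta>) * x\<^sup>2 / (2 * len k * (p * (1 - p) * c\<^sup>2))))"
        by simp
      also have "\<dots> \<le> measure_pmf.prob (coins p (len k)) (G k)"
        using tail[OF pos xK xk] by (simp add: G_def x_def T_def)
      also have "exp (- ln (ln T)) = 1 / (ln b * real (Suc k))"
      proof -
        have "ln T = real (Suc k) * ln b"
          unfolding T_def N_def of_nat_power using b2 by (intro ln_realpow)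
        moreover have "ln T > 0" using T by (intro ln_gt_zero) auto
        ultimately show ?thesis by (simp add: exp_minus divide_inverse mult.commute)
      qed
      finally show ?case .
    qed
  qed
  have "\<not> summable (\<lambda>k. measure_pmf.prob (coins p (N (Suc k) - N k)) (G k))"
  proof
    assume "summable (\<lambda>k. measure_pmf.prob (coins p (N (Suc k) - N k)) (G k))"
    then have "summable (\<lambda>k. 1 / (ln b * real (Suc k)))"
    proof (rule summable_comparison_test_ev[rotated])
      show "\<forall>\<^sub>F k in sequentially. norm (1 / (ln b * real (Suc k)))
          \<le> measure_pmf.prob (coins p (N (Suc k) - N k)) (G k)"
        using prob_G b2 unfolding len_def by simp
    qed
    then have "summable (\<lambda>k. ln b * (1 / (ln b * real (Suc k))))" by (rule summable_mult)
    moreover have "ln b * (1 / (ln b * real (Suc k))) = inverse (real (Suc k))" for k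
    proof -
      have "ln (real b) \<noteq> 0" using b2 by simp
      then show ?thesis by (simp add: inverse_eq_divide del: of_nat_Suc)
    qed
    ultimately have "summable (\<lambda>k. inverse (real (Suc k)))" by simp
    then have "summable (\<lambda>k. inverse (real k))" by (subst (asm) summable_Suc_iff)
    then show False using not_summable_harmonic[where 'a = real] by blast
  qed
  note io = blocks_infinitely_often[OF mono_N this]
  have "AE x in M. \<forall>\<^sub>F n in sequentially. - c * excess p (outcomes n x) \<le> 2 * \<sigma> * lil_scale n"
    by (rule lil_upper[of \<sigma>]) (use \<sigma> in auto)
  then show ?thesis
    using io
  proof eventually_elim
    case (elim x)
    have "\<forall>\<^sub>F k in sequentially. - c * excess p (outcomes (N k) x) \<le> 2 * \<sigma> * lil_scale (N k)"
    proof -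
      have "filterlim N sequentially sequentially"
        using N_top by (simp add: filterlim_sequentially_iff_filterlim_real)
      with elim(1) show ?thesis by (rule eventually_compose_filterlim)
    qed
    then have ev: "\<forall>\<^sub>F k in sequentially. drop (N k) (outcomes (N (Suc k)) x) \<in> G k \<longrightarrow>
        s * lil_scale (N (Suc k)) \<le> c * excess p (outcomes (N (Suc k)) x)"
      using large
    proof eventually_elim
      case (elim k)
      show ?case
      proof
        assume "drop (N k) (outcomes (N (Suc k)) x) \<in> G k"
        moreover have "outcomes (N (Suc k)) x = outcomes (N k) x @ drop (N k) (outcomes (N (Suc k)) x)"
        proof -
          have "N k \<le> N (Suc k)" using mono_N by (simp add: mono_def)
          then show ?thesis
            using append_take_drop_id[of "N k" "outcomes (N (Suc k)) x"] by (simp add: take_outcomes)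
        qed
        then have "excess p (outcomes (N (Suc k)) x)
            = excess p (outcomes (N k) x) + excess p (drop (N k) (outcomes (N (Suc k)) x))"
          by (metis excess_append)
        ultimately have "s1 * lil_scale (N (Suc k)) - 2 * \<sigma> * lil_scale (N k)
            \<le> c * excess p (outcomes (N (Suc k)) x)"
          using elim(1) by (simp add: G_def distrib_left)
        moreover have "2 * \<sigma> * lil_scale (N k) \<le> (s1 - s) * lil_scale (N (Suc k))"
        proof -
          have "sqrt b * lil_scale (N k) \<le> lil_scale (N (Suc k))"
          proof -
            have "ln (ln (N k)) \<le> ln (ln (N (Suc k)))"
            proof -
              have "1 < N k" "N k \<le> N (Suc k)" using elim(2) mono_N by (auto simp: mono_def)
              then show ?thesis by (intro ln_mono ln_gt_zero) auto
            qed
            then show ?thesis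
              unfolding lil_scale_def real_sqrt_mult[symmetric] len(2)
              by (intro real_sqrt_le_mono) (simp add: mult_left_mono)
          qed
          then have "(s1 - s) * (sqrt b * lil_scale (N k)) \<le> (s1 - s) * lil_scale (N (Suc k))"
            using s1 by (intro mult_left_mono) auto
          moreover have "2 * \<sigma> * lil_scale (N k) \<le> (s1 - s) * sqrt b * lil_scale (N k)"
            using b_past lil_scale_nonneg[OF elim(2)] by (rule mult_right_mono)
          ultimately show ?thesis by simp
        qed
        ultimately show "s * lil_scale (N (Suc k)) \<le> c * excess p (outcomes (N (Suc k)) x)"
          by (simp add: left_diff_distrib)
      qed
    qed
    show ?case
      unfolding frequently_sequentially
    proof
      fix m
      have "\<forall>\<^sub>F k in sequentially. m \<le> N (Suc k)"
      proof -
        have "\<forall>\<^sub>F k in sequentially. real m \<le> real (N (Suc k))"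
          using N_top' unfolding filterlim_at_top by blast
        then show ?thesis by simp
      qed
      from frequently_ex[OF frequently_rev_mp[OF elim(2) eventually_elim2[OF ev this]]]
      show "\<exists>n\<ge>m. s * lil_scale n \<le> c * excess p (outcomes n x)" by blast
    qed
  qed
qed

end

section \<open>Binary digits under a Bernoulli product\<close>

text \<open>
  Digits are counted from \<open>0\<close>, so that \<open>binary_digit i\<close> belongs to the weight \<open>2 powr - (i + 1)\<close>.  Dyadic rationals
  get the expansion ending in zeros, in accordance with half-open intervals.
\<close>

definition binary_digit :: "nat \<Rightarrow> real \<Rightarrow> bool" where
  "binary_digit i x \<longleftrightarrow> odd \<lfloor>2 ^ Suc i * x\<rfloor>"

lemma floor_Suc_power: "\<lfloor>2 ^ Suc n * x\<rfloor> = 2 * \<lfloor>2 ^ n * x\<rfloor> + of_bool (binary_digit n x)"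
proof -
  let ?k = "\<lfloor>2 ^ n * x\<rfloor>"
  have "2 * ?k \<le> \<lfloor>2 ^ Suc n * x\<rfloor>" "\<lfloor>2 ^ Suc n * x\<rfloor> < 2 * ?k + 2"
    by (simp_all add: le_floor_iff floor_less_iff) linarith+
  then have "\<lfloor>2 ^ Suc n * x\<rfloor> = 2 * ?k \<or> \<lfloor>2 ^ Suc n * x\<rfloor> = 2 * ?k + 1" by linarith
  then show ?thesis unfolding binary_digit_def by auto
qed

definition binary_digits :: "nat \<Rightarrow> real \<Rightarrow> bool list" where
  "binary_digits n x = map (\<lambda>i. binary_digit i x) [0..<n]"

lemma binary_digits_0 [simp]: "binary_digits 0 x = []"
  and binary_digits_Suc: "binary_digits (Suc n) x = binary_digits n x @ [binary_digit n x]"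
  by (simp_all add: binary_digits_def)

lemma length_binary_digits [simp]: "length (binary_digits n x) = n"
  by (simp add: binary_digits_def)

lemma binary_digits_eq_iff:
  assumes "x \<in> {0..<1}" "y \<in> {0..<1}"
  shows "binary_digits n x = binary_digits n y \<longleftrightarrow> \<lfloor>2 ^ n * x\<rfloor> = \<lfloor>2 ^ n * y\<rfloor>"
proof (induction n)
  case 0
  have "\<lfloor>x\<rfloor> = 0" "\<lfloor>y\<rfloor> = 0" using assms by (auto simp: floor_eq_iff)
  then show ?case by simp
next
  case (Suc n)
  have "2 * a + of_bool P = 2 * b + of_bool Q \<longleftrightarrow> a = b \<and> P = Q" for a b :: int and P Q
    by (auto simp: of_bool_def) presburger+
  then show ?case
    using Suc by (simp only: binary_digits_Suc floor_Suc_power append1_eq_conv)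
qed

text \<open>
  The points sharing their first \<open>n\<close> digits with \<open>x\<close> are those with the same integer part after
  multiplication by \<open>2 ^ n\<close>.
\<close>

lemma binary_cylinder_eq:
  assumes x: "x \<in> {0..<1}"
  shows "{y \<in> {0..<1}. binary_digits n y = binary_digits n x} =
    {\<lfloor>2 ^ n * x\<rfloor> / 2 ^ n ..< (\<lfloor>2 ^ n * x\<rfloor> + 1) / 2 ^ n}"
proof -
  let ?k = "\<lfloor>2 ^ n * x\<rfloor>"
  have k: "0 \<le> ?k" "?k < 2 ^ n"
    using x by (auto simp: le_floor_iff floor_less_iff)
  have iff: "\<lfloor>2 ^ n * y\<rfloor> = ?k \<longleftrightarrow> ?k / 2 ^ n \<le> y \<and> y < (?k + 1) / 2 ^ n" for y
    by (simp add: floor_eq_iff field_simps)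
  have unit: "y \<in> {0..<1}" if "?k / 2 ^ n \<le> y" "y < (?k + 1) / 2 ^ n" for y
  proof -
    have "0 \<le> ?k / 2 ^ n" using k by simp
    moreover have "real_of_int ?k + 1 \<le> 2 ^ n"
      using k(2) by (metis int_le_real_less of_int_add of_int_1 of_int_le_numeral_power_cancel_iff zless_imp_add1_zle)
    then have "(?k + 1) / 2 ^ n \<le> 1" by (simp add: divide_le_eq)
    ultimately show ?thesis using that by (auto intro: order_trans less_le_trans)
  qed
  show ?thesis
    using unit by (auto simp: binary_digits_eq_iff[OF _ x] iff)
qed

lemma diameter_Ico: "a \<le> b \<Longrightarrow> diameter {a..<b::real} = b - a"
proof (cases "a = b")
  case False
  assume "a \<le> b"
  have "diameter {a<..<b} \<le> diameter {a..<b}"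
    by (rule diameter_subset) auto
  moreover have "diameter {a..<b} \<le> diameter {a..b}"
    by (rule diameter_subset) auto
  ultimately show ?thesis using \<open>a \<le> b\<close> by simp
qed simp

lemma diameter_binary_cylinder:
  assumes "x \<in> {0..<1}"
  shows "diameter {y \<in> {0..<1}. binary_digits n y = binary_digits n x} = (1 / 2) ^ n"
  unfolding binary_cylinder_eq[OF assms]
  by (subst diameter_Ico) (simp_all add: divide_right_mono power_divide flip: diff_divide_distrib)

text \<open>
  By induction on \<open>n\<close>, the left end point is \<open>k / 2 ^ n\<close> for an integer \<open>k\<close> with \<open>0 \<le> k < 2 ^ n\<close>, and prescribing
  the digits of \<open>x\<close> amounts to prescribing \<open>\<lfloor>2 ^ n * x\<rfloor> = k\<close>; appending a digit \<open>e\<close> replaces \<open>k\<close> by \<open>2 k + e\<close>.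
\<close>

lemma dyadic_interval_eq:
  assumes e: "\<And>i. i \<in> {1..n} \<Longrightarrow> e i \<in> {0, 1}"
  shows "dyadic_interval e n = {x \<in> {0..<1}. binary_digits n x = map (\<lambda>i. e (Suc i) = 1) [0..<n]}"
proof -
  define a where "a n = (\<Sum>i=1..n. real (e i) * (1/2) ^ i)" for n
  have "\<exists>k::int. 2 ^ n * a n = k \<and> 0 \<le> k \<and> k < 2 ^ n \<and>
      (\<forall>x\<in>{0..<1}. binary_digits n x = map (\<lambda>i. e (Suc i) = 1) [0..<n] \<longleftrightarrow> \<lfloor>2 ^ n * x\<rfloor> = k)"
    using e
  proof (induction n)
    case 0
    then show ?case by (intro exI[of _ 0]) (auto simp: a_def floor_eq_iff)
  next
    case (Suc n)
    then obtain k :: int where k: "2 ^ n * a n = k" "0 \<le> k" "k < 2 ^ n" and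
      dig: "\<And>x. x \<in> {0..<1} \<Longrightarrow> binary_digits n x = map (\<lambda>i. e (Suc i) = 1) [0..<n] \<longleftrightarrow> \<lfloor>2 ^ n * x\<rfloor> = k"
      by force
    have eS: "e (Suc n) = 0 \<or> e (Suc n) = 1" using Suc.prems[of "Suc n"] by auto
    show ?case
    proof (intro exI[of _ "2 * k + int (e (Suc n))"] conjI ballI)
      have "a (Suc n) = a n + e (Suc n) * (1 / 2) ^ Suc n" by (simp add: a_def)
      then have "2 ^ Suc n * a (Suc n) = 2 * (2 ^ n * a n) + e (Suc n)"
        by (simp add: algebra_simps power_divide)
      then show "2 ^ Suc n * a (Suc n) = real_of_int (2 * k + int (e (Suc n)))"
        using k(1) by simp
      show "0 \<le> 2 * k + int (e (Suc n))" "2 * k + int (e (Suc n)) < 2 ^ Suc n"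
        using k eS by auto
      fix x :: real assume x: "x \<in> {0..<1}"
      have "2 * l + of_bool P = 2 * k + int (e (Suc n)) \<longleftrightarrow> l = k \<and> P = (e (Suc n) = 1)" for l :: int and P
        using eS by (auto simp: of_bool_def) presburger+
      then show "binary_digits (Suc n) x = map (\<lambda>i. e (Suc i) = 1) [0..<Suc n] \<longleftrightarrow>
          \<lfloor>2 ^ Suc n * x\<rfloor> = 2 * k + int (e (Suc n))"
        unfolding floor_Suc_power by (simp add: binary_digits_Suc dig[OF x] del: One_nat_def)
    qed
  qed
  then obtain k :: int where k: "2 ^ n * a n = k" "0 \<le> k" "k < 2 ^ n" and
    dig: "\<And>x. x \<in> {0..<1} \<Longrightarrow> binary_digits n x = map (\<lambda>i. e (Suc i) = 1) [0..<n] \<longleftrightarrow> \<lfloor>2 ^ n * x\<rfloor> = k"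
    by blast
  have an: "a n = k / 2 ^ n" using k(1) by (simp add: field_simps)
  have mem: "x \<in> dyadic_interval e n \<longleftrightarrow> \<lfloor>2 ^ n * x\<rfloor> = k" for x
    unfolding dyadic_interval_def a_def[symmetric] an
    by (simp add: floor_eq_iff power_divide field_simps)
  have unit: "x \<in> {0..<1}" if "\<lfloor>2 ^ n * x\<rfloor> = k" for x :: real
  proof -
    have "0 \<le> 2 ^ n * x" using that k(2) by linarith
    moreover have "2 ^ n * x < 2 ^ n"
    proof -
      have "\<lfloor>2 ^ n * x\<rfloor> < 2 ^ n" using that k(3) by simp
      then show ?thesis by (simp add: floor_less_iff)
    qed
    ultimately show ?thesis by (simp add: zero_le_mult_iff power_le_zero_eq)
  qed
  show ?thesis using mem dig unit by blast
qed

lemma word_weight_conv_count: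
  "word_weight p w = p ^ sum_list (map of_bool w) * (1 - p) ^ (length w - sum_list (map of_bool w))"
proof (induction w)
  case (Cons b w)
  have "sum_list (map of_bool w) \<le> length w"
    by (induction w) (auto simp: of_bool_def)
  then show ?case using Cons by (cases b) (simp_all add: word_weight_def Suc_diff_le)
qed (simp add: word_weight_def)

text \<open>
  The constant \<open>d\<close> is the mean of \<open>- log 2\<close> of the weight of one toss and \<open>c\<close> the difference of the two
  values of \<open>log 2\<close> of it, which determines a function on two points.
\<close>

lemma word_weight_eq_powr:
  assumes p: "0 < p" "p < 1"
    and d: "d = - p * log 2 p - (1 - p) * log 2 (1 - p)" and c: "c = log 2 (p / (1 - p))"
  shows "word_weight p w = 2 powr (- (d * length w) + c * excess p w)"
proof (induction w)
  case (Cons b w)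
  have "(if b then p else 1 - p) = 2 powr (- d + c * (of_bool b - p))"
  proof (cases b)
    case True
    have "- d + c * (1 - p) = log 2 p"
      using p unfolding d c by (simp add: log_divide algebra_simps)
    then show ?thesis using True p by simp
  next
    case False
    have "- d + c * (0 - p) = log 2 (1 - p)"
      using p unfolding d c by (simp add: log_divide algebra_simps)
    then show ?thesis using False p by simp
  qed
  then have "word_weight p (b # w) = 2 powr ((- d + c * (of_bool b - p)) + (- (d * length w) + c * excess p w))"
    using Cons by (simp only: powr_add) (simp add: word_weight_def)
  also have "(- d + c * (of_bool b - p)) + (- (d * length w) + c * excess p w)
      = - (d * length (b # w)) + c * excess p (b # w)"
    by (simp add: algebra_simps)
  finally show ?case .
qed (simp add: word_weight_def)

lemma bernoulli_product_space:
  assumes "bernoulli_product p m"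
  shows "prob_space m" "space m = {0..<1}" "sets m = sets (restrict_space borel {0..<1})"
proof -
  show 1: "prob_space m" "sets m = sets (restrict_space borel {0..<1})"
    using assms by (auto simp: bernoulli_product_def)
  show "space m = {0..<1}"
    using sets_eq_imp_space_eq[OF 1(2)] by (simp add: space_restrict_space)
qed

lemma bernoulli_product_cylinder:
  assumes m: "bernoulli_product p m" and w: "length w = n"
  shows "measure m {x \<in> space m. binary_digits n x = w} = word_weight p w"
proof (cases "n = 0")
  case True
  interpret prob_space m using bernoulli_product_space[OF m] by blast
  show ?thesis using True w prob_space by (simp add: word_weight_def)
next
  case False
  define e :: "nat \<Rightarrow> nat" where "e i = of_bool (w ! (i - 1))" for i
  have e: "e i \<in> {0, 1}" for i by (simp add: e_def)
  have "map (\<lambda>i. e (Suc i) = 1) [0..<n] = w"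
    using w by (intro nth_equalityI) (auto simp: e_def)
  then have "measure m {x \<in> space m. binary_digits n x = w} = measure m (dyadic_interval e n)"
    using dyadic_interval_eq[of n e] e by (simp add: bernoulli_product_space[OF m])
  also have "\<dots> = p ^ (\<Sum>i=1..n. e i) * (1 - p) ^ (n - (\<Sum>i=1..n. e i))"
    using m False e by (auto simp: bernoulli_product_def)
  also have "(\<Sum>i=1..n. e i) = sum_list (map of_bool w)"
  proof -
    have "(\<Sum>i=1..n. e i) = (\<Sum>i<n. e (Suc i))"
      by (rule sum.reindex_bij_witness[of _ Suc "\<lambda>i. i - 1"]) auto
    also have "\<dots> = (\<Sum>i<n. map of_bool w ! i)" by (rule sum.cong) (use w in \<open>auto simp: e_def\<close>)
    finally show ?thesis using w by (simp add: sum_list_sum_nth lessThan_atLeast0)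
  qed
  finally show ?thesis using w by (simp add: word_weight_conv_count)
qed

lemma measurable_binary_digits:
  assumes "bernoulli_product p m"
  shows "binary_digits n \<in> measurable m (count_space UNIV)"
proof (induction n)
  case (Suc n)
  have [measurable]: "binary_digit i \<in> measurable borel (count_space UNIV)" for i
    unfolding binary_digit_def[abs_def] by measurable
  have "binary_digit i \<in> measurable m (count_space UNIV)" for i
    by (subst measurable_cong_sets[OF bernoulli_product_space(3)[OF assms] refl])
       (rule measurable_restrict_space1, measurable)
  with Suc show ?case
    unfolding binary_digits_Suc[abs_def] by measurable
qed simp

theorem bernoulli_product_coin_process:
  assumes p: "0 < p" "p < 1" and m: "bernoulli_product p m"
  shows "coin_process m p binary_digit"
proof -
  interpret prob_space m using bernoulli_product_space[OF m] by blast
  have meas [measurable]: "binary_digits n \<in> measurable m (count_space UNIV)" for n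
    by (rule measurable_binary_digits[OF m])
  show ?thesis
  proof unfold_locales
    fix n
    show "(\<lambda>x. map (\<lambda>i. binary_digit i x) [0..<n]) \<in> measurable m (count_space UNIV)"
      using meas[of n] by (simp add: binary_digits_def[abs_def])
    have "distr m (count_space UNIV) (binary_digits n) = measure_pmf (coins p n)"
    proof (rule measure_eqI_countable[where A = UNIV])
      fix w :: "bool list"
      have "emeasure (distr m (count_space UNIV) (binary_digits n)) {w}
          = emeasure m {x \<in> space m. binary_digits n x = w}"
        by (subst emeasure_distr) (auto intro!: arg_cong[where f = "emeasure m"])
      also have "\<dots> = ennreal (if length w = n then word_weight p w else 0)"
      proof (cases "length w = n")
        case True
        then show ?thesis
          using bernoulli_product_cylinder[OF m True] by (simp add: emeasure_eq_measure)
      next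
        case False
        then have "{x \<in> space m. binary_digits n x = w} = {}" by auto
        then show ?thesis using False by (simp only: emeasure_empty) simp
      qed
      also have "\<dots> = emeasure (measure_pmf (coins p n)) {w}"
        using p by (simp add: emeasure_pmf_single pmf_coins)
      finally show "emeasure (distr m (count_space UNIV) (binary_digits n)) {w}
          = emeasure (measure_pmf (coins p n)) {w}" .
    qed (auto simp: countableI_type)
    then show "distr m (count_space UNIV) (\<lambda>x. map (\<lambda>i. binary_digit i x) [0..<n]) = measure_pmf (coins p n)"
      by (simp add: binary_digits_def[abs_def])
  qed (rule p)+
qed

section \<open>Hausdorff measures\<close>

lemma hausdorff_premeasure_eq_0:
  assumes "hausdorff_measure \<Psi> E = 0" "\<eta> > 0"
  shows "hausdorff_premeasure \<Psi> \<eta> E = 0"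
proof -
  have "hausdorff_premeasure \<Psi> \<eta> E \<le> hausdorff_measure \<Psi> E"
    unfolding hausdorff_measure_eq_SUP using assms(2) by (intro SUP_upper) auto
  then show ?thesis using assms(1) by simp
qed

lemma summable_on_ennreal_fun: "(f :: 'a \<Rightarrow> ennreal) summable_on S"
  by (rule nonneg_summable_on_complete) simp

lemma sum_le_infsum_ennreal:
  fixes f :: "'a \<Rightarrow> ennreal"
  assumes "finite F" "F \<subseteq> I"
  shows "sum f F \<le> (\<Sum>\<^sub>\<infinity>i\<in>I. f i)"
proof -
  have "(\<Sum>\<^sub>\<infinity>i\<in>F. f i) \<le> (\<Sum>\<^sub>\<infinity>i\<in>I. f i)"
    by (rule infsum_mono_neutral[OF summable_on_ennreal_fun summable_on_ennreal_fun]) (use assms in auto)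
  then show ?thesis using assms(1) by simp
qed

lemma hausdorff_measure_eq_0_mono:
  assumes "hausdorff_measure \<Phi> E = 0" "\<delta> > 0" "\<And>t. 0 < t \<Longrightarrow> t \<le> \<delta> \<Longrightarrow> \<Psi> t \<le> \<Phi> t"
  shows "hausdorff_measure \<Psi> E = 0"
proof -
  have "hausdorff_premeasure \<Psi> \<eta> E = 0" if "\<eta> > 0" for \<eta>
  proof -
    have "hausdorff_premeasure \<Psi> \<eta> E \<le> hausdorff_premeasure \<Psi> (min \<eta> \<delta>) E"
      by (rule hausdorff_premeasure_antimono) simp
    also have "\<dots> \<le> hausdorff_premeasure \<Phi> (min \<eta> \<delta>) E"
      unfolding hausdorff_premeasure_def
    proof (rule INF_mono)
      fix \<U> assume U: "\<U> \<in> fine_covers (min \<eta> \<delta>) E"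
      have "(\<Sum>\<^sub>\<infinity>U\<in>\<U>. ennreal (\<Psi> (diameter U))) \<le> (\<Sum>\<^sub>\<infinity>U\<in>\<U>. ennreal (\<Phi> (diameter U)))"
        by (rule infsum_mono[OF summable_on_ennreal_fun summable_on_ennreal_fun])
           (use U assms(3) in \<open>auto simp: fine_covers_def intro!: ennreal_leI\<close>)
      with U show "\<exists>\<V>\<in>fine_covers (min \<eta> \<delta>) E.
          (\<Sum>\<^sub>\<infinity>U\<in>\<V>. ennreal (\<Psi> (diameter U))) \<le> (\<Sum>\<^sub>\<infinity>U\<in>\<U>. ennreal (\<Phi> (diameter U)))" by blast
    qed
    also have "\<dots> = 0" using assms(1,2) that by (intro hausdorff_premeasure_eq_0) auto
    finally show ?thesis by simp
  qed
  then show ?thesis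
    unfolding hausdorff_measure_eq_SUP by (intro antisym SUP_least) auto
qed

lemma hausdorff_measure_subset:
  assumes "A \<subseteq> B" "hausdorff_measure \<Psi> B = 0"
  shows "hausdorff_measure \<Psi> A = 0"
proof -
  have "hausdorff_premeasure \<Psi> \<eta> A \<le> hausdorff_premeasure \<Psi> \<eta> B" for \<eta>
    unfolding hausdorff_premeasure_def
    by (rule INF_superset_mono) (use assms(1) in \<open>auto simp: fine_covers_def\<close>)
  then have "hausdorff_measure \<Psi> A \<le> hausdorff_measure \<Psi> B"
    unfolding hausdorff_measure_eq_SUP by (intro SUP_mono) auto
  then show ?thesis using assms(2) by simp
qed

lemma emeasure_UN_le_infsum:
  assumes "countable I" "\<And>i. i \<in> I \<Longrightarrow> X i \<in> sets M"
  shows "emeasure M (\<Union>i\<in>I. X i) \<le> (\<Sum>\<^sub>\<infinity>i\<in>I. emeasure M (X i))"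
proof (cases "I = {}")
  case False
  define F where "F n = from_nat_into I ` {..<n}" for n
  have F: "finite (F n)" "F n \<subseteq> I" for n
    using from_nat_into[OF False] by (auto simp: F_def)
  define Y where "Y n = (\<Union>i\<in>F n. X i)" for n
  have Y: "range Y \<subseteq> sets M" "incseq Y"
    using F assms(2) by (auto simp: Y_def F_def incseq_def intro!: sets.finite_UN) fastforce+
  have "(\<Union>i\<in>I. X i) = (\<Union>n. Y n)"
  proof -
    have "\<exists>n. i \<in> F n" if "i \<in> I" for i
    proof (intro exI)
      show "i \<in> F (Suc (to_nat_on I i))"
        unfolding F_def using from_nat_into_to_nat_on[OF assms(1) that]
        by (intro image_eqI[of _ _ "to_nat_on I i"]) auto
    qed
    then have "I = (\<Union>n. F n)" using F(2) by blast
    then show ?thesis unfolding Y_def by simp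
  qed
  then have "emeasure M (\<Union>i\<in>I. X i) = (SUP n. emeasure M (Y n))"
    using SUP_emeasure_incseq[OF Y] by simp
  also have "\<dots> \<le> (\<Sum>\<^sub>\<infinity>i\<in>I. emeasure M (X i))"
  proof (rule SUP_least)
    fix n
    have "emeasure M (Y n) \<le> (\<Sum>i\<in>F n. emeasure M (X i))"
      unfolding Y_def using F assms(2) by (intro emeasure_subadditive_finite) auto
    also have "\<dots> \<le> (\<Sum>\<^sub>\<infinity>i\<in>I. emeasure M (X i))"
      using F by (intro sum_le_infsum_ennreal)
    finally show "emeasure M (Y n) \<le> (\<Sum>\<^sub>\<infinity>i\<in>I. emeasure M (X i))" .
  qed
  finally show ?thesis .
qed simp

lemma infsum_ennreal_le_cmult:
  fixes f g :: "'a \<Rightarrow> ennreal"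
  assumes "\<And>i. i \<in> I \<Longrightarrow> f i \<le> C * g i"
  shows "(\<Sum>\<^sub>\<infinity>i\<in>I. f i) \<le> C * (\<Sum>\<^sub>\<infinity>i\<in>I. g i)"
proof (rule infsum_le_finite_sums)
  fix F assume F: "finite F" "F \<subseteq> I"
  have "sum f F \<le> (\<Sum>i\<in>F. C * g i)" using assms F by (intro sum_mono) auto
  also have "\<dots> = C * sum g F" by (simp add: sum_distrib_left)
  also have "\<dots> \<le> C * (\<Sum>\<^sub>\<infinity>i\<in>I. g i)"
    using F by (intro mult_left_mono sum_le_infsum_ennreal) auto
  finally show "sum f F \<le> C * (\<Sum>\<^sub>\<infinity>i\<in>I. g i)" .
qed (rule summable_on_ennreal_fun)

lemma Theta_eq_lil_scale: "Theta t = 2 powr lil_scale (log 2 (1 / t))"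
  by (simp add: Theta_def lil_scale_def)

lemma Theta_powr: "Theta t powr s = 2 powr (s * lil_scale (log 2 (1 / t)))"
  by (simp add: Theta_eq_lil_scale powr_powr mult.commute)

lemma half_power_powr: "((1 / 2 :: real) ^ n) powr d = 2 powr (- (d * n))"
proof -
  have "(1 / 2 :: real) ^ n = 2 powr - real n"
    by (simp add: powr_minus powr_realpow power_divide inverse_eq_divide)
  then show ?thesis by (simp add: powr_powr mult.commute)
qed

lemma gauge_dyadic: "((1 / 2) ^ n) powr d * Theta ((1 / 2) ^ n) powr s = 2 powr (- (d * n) + s * lil_scale n)"
proof -
  have "log 2 (1 / (1 / 2) ^ n) = n" by (simp add: power_divide)
  then show ?thesis by (simp only: Theta_powr powr_add half_power_powr)
qed

text \<open>
  Passing from a dyadic length to a smaller \<open>t\<close> of the same scale costs at most a factor \<open>2 powr d\<close> in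
  \<open>t powr d\<close>, while \<open>Theta\<close> increases as \<open>t\<close> decreases.
\<close>

lemma gauge_ge_dyadic:
  assumes "(1 / 2) ^ Suc n < t" "t \<le> (1 / 2) ^ n" "3 \<le> n" "0 \<le> s" "0 \<le> d"
  shows "2 powr (- (d * n) + s * lil_scale n) \<le> 2 powr d * (t powr d * Theta t powr s)"
proof -
  have t: "t > 0" using assms(1) by (rule less_trans[rotated]) simp
  have "2 powr (- (d * n)) = 2 powr d * ((1 / 2) ^ Suc n) powr d"
  proof -
    have "- (d * n) = d + - (d * Suc n)" by (simp add: algebra_simps)
    then show ?thesis by (simp only: half_power_powr powr_add)
  qed
  also have "\<dots> \<le> 2 powr d * t powr d"
    using assms by (intro mult_left_mono powr_mono2) auto
  finally have 1: "2 powr (- (d * n)) \<le> 2 powr d * t powr d" .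
  have "real n \<le> log 2 (1 / t)"
  proof -
    have "2 ^ n \<le> 1 / t" using assms(2) t by (simp add: field_simps power_divide)
    then show ?thesis using t by (subst le_log_iff) (auto simp: powr_realpow)
  qed
  then have "lil_scale n \<le> lil_scale (log 2 (1 / t))"
    using assms(3) by (intro lil_scale_mono) auto
  then have 2: "2 powr (s * lil_scale n) \<le> Theta t powr s"
    unfolding Theta_powr using assms(4) by (simp add: mult_left_mono)
  have "2 powr (- (d * n) + s * lil_scale n) \<le> (2 powr d * t powr d) * Theta t powr s"
    unfolding powr_add using 1 2 by (intro mult_mono) auto
  then show ?thesis by (simp add: mult.assoc)
qed

text \<open>
  The dyadic scale of a length: the generation in which dyadic intervals are at least as long as \<open>t\<close>, but
  less than twice as long.
\<close>

lemma dyadic_generation: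
  fixes t :: real
  assumes "0 < t" "t \<le> (1 / 2) ^ N"
  obtains n where "N \<le> n" "(1 / 2) ^ Suc n < t" "t \<le> (1 / 2) ^ n"
proof -
  define n where "n = (LEAST n. (1 / 2) ^ Suc n < t)"
  obtain n0 where "(1 / 2) ^ n0 < t" using real_arch_pow_inv[OF assms(1), of "1 / 2"] by auto
  moreover have "(1 / 2 :: real) ^ Suc n0 \<le> (1 / 2) ^ n0" by (rule power_decreasing) auto
  ultimately have "(1 / 2) ^ Suc n0 < t" by linarith
  then have 1: "(1 / 2) ^ Suc n < t" unfolding n_def by (rule LeastI)
  have 2: "t \<le> (1 / 2) ^ n" if n: "n \<noteq> 0"
  proof -
    obtain k where k: "n = Suc k" using not0_implies_Suc[OF n] by blast
    then have "k < (LEAST n. (1 / 2) ^ Suc n < t)" unfolding n_def by simp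
    then have "\<not> (1 / 2) ^ Suc k < t" by (rule not_less_Least)
    then show ?thesis using k by simp
  qed
  have le: "N \<le> n"
  proof (rule ccontr)
    assume "\<not> N \<le> n"
    then have "(1 / 2 :: real) ^ N \<le> (1 / 2) ^ Suc n" by (intro power_decreasing) auto
    then show False using 1 assms(2) by linarith
  qed
  have "t \<le> (1 / 2) ^ n"
    using 2 le assms(2) by (cases "n = 0") auto
  with le 1 that show thesis by blast
qed

section \<open>Bernoulli products against Hausdorff measures\<close>

locale bernoulli_measure =
  fixes p d c :: real and m :: "real measure"
  assumes p_pos: "0 < p" and p_less_1: "p < 1" and bernoulli: "bernoulli_product p m"
    and d_eq: "d = - p * log 2 p - (1 - p) * log 2 (1 - p)"
    and c_eq: "c = log 2 (p / (1 - p))"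
begin

sublocale coin_process m p binary_digit
  by (rule bernoulli_product_coin_process[OF p_pos p_less_1 bernoulli])

lemma outcomes_eq: "outcomes = binary_digits"
  by (auto simp: fun_eq_iff outcomes_def binary_digits_def)

lemma space_m: "space m = {0..<1}"
  using bernoulli_product_space[OF bernoulli] by simp

lemma d_nonneg: "0 \<le> d"
proof -
  have "log 2 p \<le> 0" "log 2 (1 - p) \<le> 0" using p by auto
  then have "p * log 2 p \<le> 0" "(1 - p) * log 2 (1 - p) \<le> 0"
    using p by (simp_all add: mult_nonneg_nonpos)
  then show ?thesis unfolding d_eq by simp
qed

definition cylinder :: "nat \<Rightarrow> real \<Rightarrow> real set" where
  "cylinder n x = {y \<in> space m. outcomes n y = outcomes n x}"

lemma sets_cylinder [measurable, simp]: "cylinder n x \<in> sets m"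
  unfolding cylinder_def by measurable

lemma cylinder_bounded [simp]: "bounded (cylinder n x)"
  by (rule bounded_subset[of "{0..1}"]) (auto simp: cylinder_def space_m)

lemma diameter_cylinder: "x \<in> space m \<Longrightarrow> diameter (cylinder n x) = (1 / 2) ^ n"
  using diameter_binary_cylinder[of x n] by (simp add: cylinder_def space_m outcomes_eq)

lemma emeasure_cylinder:
  "emeasure m (cylinder n x) = 2 powr (- (d * n) + c * excess p (outcomes n x))"
proof -
  have "measure m (cylinder n x) = word_weight p (outcomes n x)"
    using bernoulli_product_cylinder[OF bernoulli, of "outcomes n x" n]
    by (simp add: cylinder_def outcomes_eq)
  then show ?thesis
    using word_weight_eq_powr[OF p d_eq c_eq, of "outcomes n x"] by (simp add: emeasure_eq_measure)
qed

text \<open>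
  A set of diameter at most \<open>2 powr - n\<close> meets at most two dyadic intervals of generation \<open>n\<close>, and a dyadic
  interval that contains a point of \<open>A\<close> has small measure by the assumption on that point.
  The set \<open>U\<close> of a cover need not be measurable, which is why the set \<open>V\<close> is used in its place.
\<close>

lemma emeasure_light_le:
  fixes A :: "real set"
  assumes "0 \<le> s" "3 \<le> N" and A: "A \<in> sets m"
    and light: "\<And>x n. x \<in> A \<Longrightarrow> N \<le> n \<Longrightarrow> c * excess p (outcomes n x) \<le> s * lil_scale n"
    and U: "bounded U" "0 < diameter U" "diameter U \<le> (1 / 2) ^ N"
  obtains V where "V \<in> sets m" "A \<inter> U \<subseteq> V"
    "emeasure m V \<le> ennreal (2 * 2 powr d) * ennreal (diameter U powr d * Theta (diameter U) powr s)"
proof -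
  obtain n where n: "N \<le> n" "(1 / 2) ^ Suc n < diameter U" "diameter U \<le> (1 / 2) ^ n"
    using dyadic_generation[OF U(2,3)] by blast
  define W where "W k = {x \<in> A. \<lfloor>2 ^ n * x\<rfloor> = k}" for k
  have A_space: "A \<subseteq> space m" using A by (rule sets.sets_into_space)
  have W_cyl: "W \<lfloor>2 ^ n * x\<rfloor> = A \<inter> cylinder n x" if "x \<in> A" for x
    using A_space that binary_digits_eq_iff[of _ x n]
    by (auto simp: W_def cylinder_def space_m outcomes_eq subset_eq)
  have W_sets: "W k \<in> sets m" for k
  proof (cases "W k = {}")
    case False
    then obtain x where "x \<in> A" "k = \<lfloor>2 ^ n * x\<rfloor>" by (auto simp: W_def)
    then show ?thesis using W_cyl A by simp
  qed simp
  have W_le: "emeasure m (W k) \<le> 2 powr (- (d * n) + s * lil_scale n)" for k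
  proof (cases "W k = {}")
    case False
    then obtain x where x: "x \<in> A" "k = \<lfloor>2 ^ n * x\<rfloor>" by (auto simp: W_def)
    then have "emeasure m (W k) \<le> emeasure m (cylinder n x)"
      using W_cyl by (intro emeasure_mono) auto
    also have "\<dots> \<le> 2 powr (- (d * n) + s * lil_scale n)"
      unfolding emeasure_cylinder using light[OF x(1) n(1)] by (intro ennreal_leI) simp
    finally show ?thesis .
  qed simp
  define j where "j = \<lfloor>2 ^ n * Inf U\<rfloor>"
  show thesis
  proof (rule that[of "W j \<union> W (j + 1)"])
    show "W j \<union> W (j + 1) \<in> sets m" using W_sets by simp
    show "A \<inter> U \<subseteq> W j \<union> W (j + 1)"
    proof
      fix x assume x: "x \<in> A \<inter> U"
      have bdd: "bdd_below U" using U(1) by (rule bounded_imp_bdd_below)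
      have low: "Inf U \<le> x" using x bdd by (intro cInf_lower) auto
      have "x - diameter U \<le> Inf U"
      proof (rule cInf_greatest)
        fix y assume "y \<in> U"
        then have "dist x y \<le> diameter U" using x U(1) by (intro diameter_bounded_bound) auto
        then show "x - diameter U \<le> y" by (simp add: dist_real_def)
      qed (use x in auto)
      then have "2 ^ n * x \<le> 2 ^ n * (Inf U + (1 / 2) ^ n)"
        using n(3) by (intro mult_left_mono) auto
      also have "\<dots> = 2 ^ n * Inf U + 1" by (simp add: distrib_left power_divide)
      finally have "2 ^ n * x \<le> 2 ^ n * Inf U + 1" .
      moreover have "2 ^ n * Inf U \<le> 2 ^ n * x" using low by (intro mult_left_mono) auto
      ultimately have "\<lfloor>2 ^ n * x\<rfloor> = j \<or> \<lfloor>2 ^ n * x\<rfloor> = j + 1"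
        unfolding j_def by linarith
      then show "x \<in> W j \<union> W (j + 1)" using x by (auto simp: W_def)
    qed
    have "emeasure m (W j \<union> W (j + 1)) \<le> emeasure m (W j) + emeasure m (W (j + 1))"
      using W_sets by (intro emeasure_subadditive) auto
    also have "\<dots> \<le> ennreal (2 powr (- (d * n) + s * lil_scale n)) + ennreal (2 powr (- (d * n) + s * lil_scale n))"
      by (intro add_mono W_le)
    also have "\<dots> = ennreal (2 * 2 powr (- (d * n) + s * lil_scale n))"
      by (subst ennreal_plus[symmetric]) auto
    also have "\<dots> \<le> ennreal (2 * (2 powr d * (diameter U powr d * Theta (diameter U) powr s)))"
      using assms(1,2) n d_nonneg by (intro ennreal_leI mult_left_mono gauge_ge_dyadic) auto
    also have "\<dots> = ennreal (2 * 2 powr d) * ennreal (diameter U powr d * Theta (diameter U) powr s)"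
      by (subst ennreal_mult[symmetric]) (auto simp: mult.assoc)
    finally show "emeasure m (W j \<union> W (j + 1))
        \<le> ennreal (2 * 2 powr d) * ennreal (diameter U powr d * Theta (diameter U) powr s)" .
  qed
qed

text \<open>
  The mass distribution principle: summing the previous estimate over a cover bounds the measure of the set
  by a constant times the sum of the gauges.
\<close>

lemma emeasure_light_eq_0:
  assumes "0 \<le> s" "3 \<le> N" and A: "A \<in> sets m"
    and light: "\<And>x n. x \<in> A \<Longrightarrow> N \<le> n \<Longrightarrow> c * excess p (outcomes n x) \<le> s * lil_scale n"
    and null: "hausdorff_measure (\<lambda>t. t powr d * Theta t powr s) A = 0"
  shows "emeasure m A = 0"
proof -
  let ?\<Psi> = "\<lambda>t. t powr d * Theta t powr s" and ?C = "ennreal (2 * 2 powr d)"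
  have "emeasure m A / ?C \<le> hausdorff_premeasure ?\<Psi> ((1 / 2) ^ N) A"
    unfolding hausdorff_premeasure_def
  proof (rule INF_greatest)
    fix \<U> assume U: "\<U> \<in> fine_covers ((1 / 2) ^ N) A"
    then have "countable \<U> \<and> A \<subseteq> \<Union>\<U> \<and>
        (\<forall>U\<in>\<U>. bounded U \<and> 0 < diameter U \<and> diameter U \<le> (1 / 2) ^ N)"
      unfolding fine_covers_def mem_Collect_eq .
    then have cov: "countable \<U>" "A \<subseteq> \<Union>\<U>"
      and fine: "\<forall>U\<in>\<U>. bounded U \<and> 0 < diameter U \<and> diameter U \<le> (1 / 2) ^ N"
      by blast+
    have "\<forall>U\<in>\<U>. \<exists>V. V \<in> sets m \<and> A \<inter> U \<subseteq> V \<and> emeasure m V \<le> ?C * ennreal (?\<Psi> (diameter U))"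
    proof
      fix U assume "U \<in> \<U>"
      then have "bounded U" "0 < diameter U" "diameter U \<le> (1 / 2) ^ N"
        using fine by blast+
      then obtain V where "V \<in> sets m" "A \<inter> U \<subseteq> V" "emeasure m V \<le> ?C * ennreal (?\<Psi> (diameter U))"
        using emeasure_light_le[OF assms(1-3) light] by blast
      then show "\<exists>V. V \<in> sets m \<and> A \<inter> U \<subseteq> V \<and> emeasure m V \<le> ?C * ennreal (?\<Psi> (diameter U))"
        by blast
    qed
    from bchoice[OF this] obtain V where
      V: "\<And>U. U \<in> \<U> \<Longrightarrow> V U \<in> sets m" "\<And>U. U \<in> \<U> \<Longrightarrow> A \<inter> U \<subseteq> V U"
      "\<And>U. U \<in> \<U> \<Longrightarrow> emeasure m (V U) \<le> ?C * ennreal (?\<Psi> (diameter U))"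
      by blast
    have "emeasure m A \<le> emeasure m (\<Union>U\<in>\<U>. V U)"
    proof (rule emeasure_mono)
      show "A \<subseteq> (\<Union>U\<in>\<U>. V U)" using cov(2) V(2) by blast
      show "(\<Union>U\<in>\<U>. V U) \<in> sets m" using cov(1) V(1) by (intro sets.countable_UN') auto
    qed
    also have "\<dots> \<le> (\<Sum>\<^sub>\<infinity>U\<in>\<U>. emeasure m (V U))"
      by (rule emeasure_UN_le_infsum[OF cov(1) V(1)])
    also have "\<dots> \<le> ?C * (\<Sum>\<^sub>\<infinity>U\<in>\<U>. ennreal (?\<Psi> (diameter U)))"
      by (rule infsum_ennreal_le_cmult) (rule V(3))
    finally show "emeasure m A / ?C \<le> (\<Sum>\<^sub>\<infinity>U\<in>\<U>. ennreal (?\<Psi> (diameter U)))"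
      by (intro divide_le_posI_ennreal) auto
  qed
  also have "\<dots> = 0" by (rule hausdorff_premeasure_eq_0[OF null]) simp
  finally show ?thesis by (simp add: ennreal_divide_eq_0_iff)
qed

context
  fixes \<sigma> :: real
  assumes \<sigma>: "\<sigma> > 0" "\<sigma>\<^sup>2 = p * (1 - p) * c\<^sup>2"
begin

theorem abs_cont_above:
  assumes "s > \<sigma>"
  shows "abs_cont_hausdorff m (\<lambda>t. t powr d * Theta t powr s)"
  unfolding abs_cont_hausdorff_def
proof (intro ballI impI)
  fix E assume E: "E \<in> sets m" "hausdorff_measure (\<lambda>t. t powr d * Theta t powr s) E = 0"
  \<comment> \<open>By the law of the iterated logarithm these sets exhaust E up to a null set.\<close>
  define A where "A N = {x \<in> E. \<forall>n\<ge>N. c * excess p (outcomes n x) \<le> s * lil_scale n}" for N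
  have A_sets: "A N \<in> sets m" for N
  proof -
    have "A N = E \<inter> {x \<in> space m. \<forall>n\<ge>N. c * excess p (outcomes n x) \<le> s * lil_scale n}"
      using sets.sets_into_space[OF E(1)] by (auto simp: A_def)
    also have "\<dots> \<in> sets m" using E(1) by measurable
    finally show ?thesis .
  qed
  have "emeasure m (A (max 3 N)) = 0" for N
  proof (rule emeasure_light_eq_0[where s = s and N = "max 3 N"])
    show "0 \<le> s" using assms \<sigma>(1) by simp
    show "c * excess p (outcomes n x) \<le> s * lil_scale n" if "x \<in> A (max 3 N)" "max 3 N \<le> n" for x n
      using that unfolding A_def by blast
    show "hausdorff_measure (\<lambda>t. t powr d * Theta t powr s) (A (max 3 N)) = 0"
      by (rule hausdorff_measure_subset[OF _ E(2)]) (auto simp: A_def)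
  qed (simp, rule A_sets)
  then have "AE x in m. x \<notin> A (max 3 N)" for N
    using A_sets by (intro AE_not_in) (auto simp: null_sets_def)
  then have "AE x in m. \<forall>N. x \<notin> A (max 3 N)" by (simp add: AE_all_countable)
  then have "AE x in m. x \<notin> E"
    using lil_upper[OF \<sigma> assms]
  proof eventually_elim
    case (elim x)
    then obtain N where "\<forall>n\<ge>N. c * excess p (outcomes n x) \<le> s * lil_scale n"
      by (auto simp: eventually_sequentially)
    then have "x \<in> E \<Longrightarrow> x \<in> A (max 3 N)" by (auto simp: A_def)
    with elim(1) show ?case by blast
  qed
  moreover have "{x \<in> space m. \<not> x \<notin> E} = E"
    using sets.sets_into_space[OF E(1)] by auto
  ultimately show "emeasure m E = 0"
    using AE_iff_measurable[OF E(1)] by simp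
qed

text \<open>
  Fix \<open>s'\<close> between \<open>s\<close> and \<open>\<sigma>\<close>.  Almost every point is heavy infinitely often, in the sense that
  \<open>c * excess p (outcomes n x)\<close> is at least \<open>s'\<close> times the scale at \<open>n\<close>.  Stopping each such point at its first heavy generation
  after \<open>N\<close> produces dyadic intervals that cover \<open>E\<close> and are disjoint, since all points of such an interval
  share the digits that decide when to stop.  On them the gauge is at most \<open>\<kappa> N\<close> times the measure,
  and \<open>\<kappa> N\<close> tends to \<open>0\<close> because of the gap between \<open>s\<close> and \<open>s'\<close>.
\<close>

theorem singular_below:
  assumes "s < \<sigma>"
  shows "singular_hausdorff m (\<lambda>t. t powr d * Theta t powr s)"
proof -
  let ?\<Psi> = "\<lambda>t. t powr d * Theta t powr s"
  define s' where "s' = (s + \<sigma>) / 2"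
  have s': "s < s'" "s' < \<sigma>" using assms by (auto simp: s'_def)
  define heavy where "heavy n x \<longleftrightarrow> s' * lil_scale n \<le> c * excess p (outcomes n x)" for n x
  define E where "E = {x \<in> space m. \<exists>\<^sub>F n in sequentially. heavy n x}"
  have E_sets: "E \<in> sets m"
    unfolding E_def heavy_def frequently_sequentially by measurable
  have "AE x in m. x \<in> E"
    using lil_lower[OF \<sigma> s'(2)] by (auto simp: E_def heavy_def)
  then have "emeasure m E = 1" using E_sets by (simp add: emeasure_eq_1_AE)
  moreover have "hausdorff_measure ?\<Psi> E = 0"
  proof -
    define \<kappa> where "\<kappa> N = 2 powr (- ((s' - s) * lil_scale (real N)))" for N
    have bound: "hausdorff_premeasure ?\<Psi> \<eta> E \<le> ennreal (\<kappa> N)" if N: "3 \<le> N" "(1 / 2) ^ N \<le> \<eta>" for N \<eta>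
    proof -
      define hit where "hit x n \<longleftrightarrow> N \<le> n \<and> heavy n x" for x n
      define \<tau> where "\<tau> x = (LEAST n. hit x n)" for x
      have hit: "hit x (\<tau> x)" if x: "x \<in> E" for x
        unfolding \<tau>_def
      proof -
        obtain n where "hit x n" using x by (auto simp: E_def frequently_sequentially hit_def)
        then show "hit x (LEAST n. hit x n)" by (rule LeastI)
      qed
      define \<U> where "\<U> = (\<lambda>x. cylinder (\<tau> x) x) ` E"
      have E_space: "E \<subseteq> space m" by (auto simp: E_def)
      have cyl_hit: "outcomes k y = outcomes k x" if "y \<in> cylinder n x" "k \<le> n" for x y k n
        using that take_outcomes[of k n x] take_outcomes[of k n y] by (simp add: cylinder_def)
      have "\<U> \<in> fine_covers \<eta> E"
        unfolding fine_covers_def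
      proof (intro CollectI conjI ballI)
        have "\<U> \<subseteq> (\<lambda>(n, w). {y \<in> space m. outcomes n y = w}) ` UNIV"
          by (auto simp: \<U>_def cylinder_def)
        then show "countable \<U>" by (rule countable_subset) (intro countable_image countableI_type)
        show "E \<subseteq> \<Union>\<U>" using E_space by (auto simp: \<U>_def cylinder_def)
        fix U assume "U \<in> \<U>"
        then obtain x where x: "x \<in> E" "U = cylinder (\<tau> x) x" by (auto simp: \<U>_def)
        have "(1 / 2 :: real) ^ \<tau> x \<le> (1 / 2) ^ N"
          using hit[OF x(1)] by (intro power_decreasing) (auto simp: hit_def)
        then show "bounded U" "0 < diameter U" "diameter U \<le> \<eta>"
          using x E_space order_trans[OF _ N(2)] by (auto simp: diameter_cylinder subset_eq)
      qed
      then have "hausdorff_premeasure ?\<Psi> \<eta> E \<le> (\<Sum>\<^sub>\<infinity>U\<in>\<U>. ennreal (?\<Psi> (diameter U)))"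
        unfolding hausdorff_premeasure_def by (rule INF_lower)
      also have "\<dots> \<le> ennreal (\<kappa> N)"
      proof (rule infsum_le_finite_sums)
        fix F assume F: "finite F" "F \<subseteq> \<U>"
        have disj: "disjoint_family_on (\<lambda>U. U) F"
          unfolding disjoint_family_on_def
        proof (intro ballI impI)
          fix U V assume "U \<in> F" "V \<in> F" and neq: "U \<noteq> V"
          then have UV: "U \<in> \<U>" "V \<in> \<U>" using F by auto
          obtain x where x: "x \<in> E" "U = cylinder (\<tau> x) x" using UV(1) unfolding \<U>_def by blast
          obtain y where y: "y \<in> E" "V = cylinder (\<tau> y) y" using UV(2) unfolding \<U>_def by blast
          have False if z: "z \<in> U" "z \<in> V" for z
          proof -
            have agree: "hit u k \<longleftrightarrow> hit z k" if "z \<in> cylinder n u" "k \<le> n" for u k n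
              using cyl_hit[OF that] by (simp add: hit_def heavy_def)
            have least: "\<tau> z = \<tau> u" if "u \<in> E" "z \<in> cylinder (\<tau> u) u" for u
              unfolding \<tau>_def[of z]
            proof (rule Least_equality)
              show "hit z (\<tau> u)" using hit[OF that(1)] agree[OF that(2)] by simp
              fix k assume "hit z k"
              then show "\<tau> u \<le> k"
                using agree[OF that(2), of k] Least_le[of "hit u" k] unfolding \<tau>_def by (cases "k \<le> \<tau> u") (auto simp: \<tau>_def)
            qed
            have "\<tau> x = \<tau> y" using least[OF x(1)] least[OF y(1)] z x y by simp
            then have "U = V" using z x(2) y(2) by (simp add: cylinder_def)
            with neq show False by simp
          qed
          then show "U \<inter> V = {}" by blast
        qed
        have U_sets: "U \<in> sets m" if "U \<in> F" for U using that F by (auto simp: \<U>_def)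
        have "(\<Sum>U\<in>F. ennreal (?\<Psi> (diameter U))) \<le> (\<Sum>U\<in>F. ennreal (\<kappa> N) * emeasure m U)"
        proof (rule sum_mono)
          fix U assume "U \<in> F"
          then obtain x where x: "x \<in> E" "U = cylinder (\<tau> x) x" using F by (auto simp: \<U>_def)
          let ?n = "\<tau> x"
          have n: "N \<le> ?n" "s' * lil_scale ?n \<le> c * excess p (outcomes ?n x)"
            using hit[OF x(1)] by (auto simp: hit_def heavy_def)
          have "lil_scale N \<le> lil_scale ?n" using n(1) N(1) by (intro lil_scale_mono) auto
          then have "(s' - s) * lil_scale N \<le> (s' - s) * lil_scale ?n" using s' by (intro mult_left_mono) auto
          then have le: "- (d * ?n) + s * lil_scale ?n
              \<le> - ((s' - s) * lil_scale N) + (- (d * ?n) + c * excess p (outcomes ?n x))"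
            using n(2) by (simp add: left_diff_distrib)
          have "x \<in> space m" using x E_space by auto
          then have "?\<Psi> (diameter U) = 2 powr (- (d * ?n) + s * lil_scale ?n)"
            unfolding x(2) by (simp only: diameter_cylinder gauge_dyadic)
          also have "\<dots> \<le> 2 powr (- ((s' - s) * lil_scale N) + (- (d * ?n) + c * excess p (outcomes ?n x)))"
            using le by (intro powr_mono) auto
          also have "\<dots> = \<kappa> N * 2 powr (- (d * ?n) + c * excess p (outcomes ?n x))"
            by (simp only: powr_add \<kappa>_def)
          finally show "ennreal (?\<Psi> (diameter U)) \<le> ennreal (\<kappa> N) * emeasure m U"
            unfolding x(2) emeasure_cylinder by (subst ennreal_mult[symmetric]) (auto simp: \<kappa>_def intro: ennreal_leI)
        qed
        also have "\<dots> = ennreal (\<kappa> N) * (\<Sum>U\<in>F. emeasure m U)" by (simp add: sum_distrib_left)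
        also have "(\<Sum>U\<in>F. emeasure m U) = emeasure m (\<Union>U\<in>F. U)"
          using U_sets by (intro sum_emeasure disj F(1)) auto
        also have "ennreal (\<kappa> N) * emeasure m (\<Union>U\<in>F. U) \<le> ennreal (\<kappa> N) * 1"
          by (intro mult_left_mono emeasure_le_1) auto
        finally show "(\<Sum>U\<in>F. ennreal (?\<Psi> (diameter U))) \<le> ennreal (\<kappa> N)" by simp
      qed (rule summable_on_ennreal_fun)
      finally show ?thesis .
    qed
    have "\<kappa> \<longlonglongrightarrow> 0"
    proof -
      have "filterlim (\<lambda>N. (s' - s) * lil_scale (real N)) at_top sequentially"
        using s' by (intro filterlim_tendsto_pos_mult_at_top[OF tendsto_const]
            filterlim_compose[OF filterlim_lil_scale filterlim_real_sequentially]) auto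
      moreover have "((\<lambda>u::real. 2 powr - u) \<longlongrightarrow> 0) at_top" by real_asymp
      ultimately show ?thesis
        unfolding \<kappa>_def by (rule filterlim_compose[rotated])
    qed
    then have lim: "(\<lambda>N. ennreal (\<kappa> N)) \<longlonglongrightarrow> 0"
      using tendsto_ennrealI by fastforce
    have "hausdorff_premeasure ?\<Psi> \<eta> E \<le> 0" if "\<eta> > 0" for \<eta>
    proof (rule tendsto_lowerbound[OF lim])
      have "\<forall>\<^sub>F N in sequentially. (1 / 2 :: real) ^ N < \<eta>"
        using that by (intro order_tendstoD(2)[OF LIMSEQ_power_zero]) auto
      then show "\<forall>\<^sub>F N in sequentially. hausdorff_premeasure ?\<Psi> \<eta> E \<le> ennreal (\<kappa> N)"
        using eventually_ge_at_top[of 3] by eventually_elim (simp add: bound)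
    qed simp
    then show ?thesis
      unfolding hausdorff_measure_eq_SUP by (intro antisym SUP_least) auto
  qed
  ultimately show ?thesis
    unfolding singular_hausdorff_def using E_sets by blast
qed

lemma singular_at_dimension: "singular_hausdorff m (\<lambda>t. t powr d)"
proof -
  have "t powr d * Theta t powr 0 = t powr d" for t
    unfolding Theta_powr by simp
  then show ?thesis using singular_below[of 0] \<sigma>(1) by (simp only:)
qed

text \<open>
  If \<open>s < d\<close>, then \<open>t powr s\<close> dominates \<open>t powr d * Theta t powr r\<close> near \<open>0\<close> for every \<open>r\<close>, because the scale
  of the iterated logarithm is sublinear; taking \<open>r = \<sigma> + 1\<close>, absolute continuity excludes that a set of
  positive measure is null for the former.
\<close>

lemma dim_ge:
  assumes E: "E \<in> sets m" "emeasure m E > 0"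
  shows "ereal d \<le> hausdorff_dim E"
  unfolding hausdorff_dim_def
proof (rule INF_greatest)
  fix s :: real assume "s \<in> {s. 0 \<le> s \<and> hausdorff_measure (\<lambda>t. t powr s) E = 0}"
  then have null: "hausdorff_measure (\<lambda>t. t powr s) E = 0" by simp
  have "d \<le> s"
  proof (rule ccontr)
    assume "\<not> d \<le> s"
    then have ds: "d - s > 0" by simp
    define r where "r = \<sigma> + 1"
    have "\<forall>\<^sub>F L in at_top. lil_scale L / L < (d - s) / r"
      using ds \<sigma>(1) by (intro order_tendstoD(2)[OF lil_scale_sublinear]) (auto simp: r_def)
    then obtain L0 where L0: "\<And>L. L \<ge> L0 \<Longrightarrow> lil_scale L / L < (d - s) / r"
      by (auto simp: eventually_at_top_linorder)
    define L1 where "L1 = max 1 L0"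
    have le: "t powr d * Theta t powr r \<le> t powr s" if t: "0 < t" "t \<le> 2 powr - L1" for t
    proof -
      define L where "L = log 2 (1 / t)"
      have t_eq: "t = 2 powr - L" using t by (simp add: L_def log_divide)
      have L: "L \<ge> L1" using t by (simp add: t_eq)
      then have "L \<ge> L0" "L > 0" by (auto simp: L1_def)
      then have "r * lil_scale L \<le> (d - s) * L"
        using L0[of L] \<sigma>(1) by (simp add: r_def field_simps)
      then have "2 powr (- L * d + r * lil_scale L) \<le> 2 powr (- L * s)"
        by (intro powr_mono) (auto simp: algebra_simps)
      then show ?thesis
        unfolding Theta_powr L_def[symmetric] unfolding t_eq powr_powr powr_add .
    qed
    have "hausdorff_measure (\<lambda>t. t powr d * Theta t powr r) E = 0"
      by (rule hausdorff_measure_eq_0_mono[OF null _ le]) auto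
    then have "emeasure m E = 0"
      using abs_cont_above[of r] E(1) by (auto simp: r_def abs_cont_hausdorff_def)
    with E(2) show False by simp
  qed
  then show "ereal d \<le> ereal s" by simp
qed

lemma dimensions: "lower_dim m = ereal d" "upper_dim m = ereal d"
proof -
  obtain E where E: "E \<in> sets m" "emeasure m E = 1" "hausdorff_measure (\<lambda>t. t powr d) E = 0"
    using singular_at_dimension by (auto simp: singular_hausdorff_def)
  have dimE: "hausdorff_dim E \<le> ereal d"
    unfolding hausdorff_dim_def using E(3) d_nonneg by (intro INF_lower) auto
  have "ereal d \<le> lower_dim m" "ereal d \<le> upper_dim m"
    unfolding lower_dim_def upper_dim_def by (intro INF_greatest dim_ge; simp)+
  moreover have "lower_dim m \<le> hausdorff_dim E" "upper_dim m \<le> hausdorff_dim E"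
    unfolding lower_dim_def upper_dim_def using E by (auto intro: INF_lower)
  ultimately show "lower_dim m = ereal d" "upper_dim m = ereal d"
    using dimE by (auto intro: antisym order_trans)
qed

end

end

theorem proposition2p1:
  fixes p d \<sigma> :: real and m :: "real measure"
  assumes "0 < p" and "p < 1" and "p \<noteq> 1/2"
    and "bernoulli_product p m"
    and "d = - p * log 2 p - (1 - p) * log 2 (1 - p)"
    and "\<sigma> > 0" and "\<sigma>\<^sup>2 = p * (1 - p) * (log 2 (p / (1 - p)))\<^sup>2"
  shows "(\<forall>\<epsilon>>0. abs_cont_hausdorff m (\<lambda>t. t powr d * Theta t powr (\<sigma> + \<epsilon>)) \<and>
                singular_hausdorff m (\<lambda>t. t powr d * Theta t powr (\<sigma> - \<epsilon>)))
         \<and> lower_dim m = ereal d \<and> upper_dim m = ereal d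
         \<and> singular_hausdorff m (\<lambda>t. t powr d)"
proof -
  interpret bernoulli_measure p d "log 2 (p / (1 - p))" m
    by unfold_locales (use assms in simp_all)
  show ?thesis
    using abs_cont_above[OF assms(6,7)] singular_below[OF assms(6,7)]
      singular_at_dimension[OF assms(6,7)] dimensions[OF assms(6,7)]
    by auto
qed

end
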